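(* (1) Let $N\ge1$, $0\le m\le N$, and let $-2N+1\le j_1<\dots<j_m<0<j_{m+1}<\dots<j_N\le 2N-1$ be integers. The number of odd OOSASM triangles of order $2N$ whose $1$-columns are exactly the columns $j_1,\dots,j_N$ (columns indexed from left to right by $-2N+1,\dots,2N-1$) is $$\left.(-\underline{\Delta}_{x_1})^{-j_1}(-\underline{\Delta}_{x_2})^{-j_1-1}\cdots(-\underline{\Delta}_{x_{2m-1}})^{-j_m}(-\underline{\Delta}_{x_{2m}})^{-j_m-1}\,\overline{\Delta}_{x_{2m+1}}^{\,j_{m+1}-1}\overline{\Delta}_{x_{2m+2}}^{\,j_{m+1}}\cdots\overline{\Delta}_{x_{2N-1}}^{\,j_N-1}\overline{\Delta}_{x_{2N}}^{\,j_N}\,M_{2N}(x_1,\dots,x_{2N})\right|_{\mathbf{x}=0}.$$ (2) Let $N\ge1$, $0\le m\le N$, and let $-2N\le j_1<\dots<j_m<0<j_{m+1}<\dots<j_N\le 2N$ be integers. The number of odd OOSASM triangles of order $2N+1$ whose $1$-columns are exactly the columns $j_1,\dots,j_m,0,j_{m+1},\dots,j_N$ (columns indexed from left to right by $-2N,\dots,2N$) is $$\left.(-\underline{\Delta}_{x_1})^{-j_1}(-\underline{\Delta}_{x_2})^{-j_1-1}\cdots(-\underline{\Delta}_{x_{2m-1}})^{-j_m}(-\underline{\Delta}_{x_{2m}})^{-j_m-1}\,\overline{\Delta}_{x_{2m+2}}^{\,j_{m+1}-1}\overline{\Delta}_{x_{2m+3}}^{\,j_{m+1}}\cdots\overline{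\Delta}_{x_{2N}}^{\,j_N-1}\overline{\Delta}_{x_{2N+1}}^{\,j_N}\,M_{2N+1}(x_1,\dots,x_{2N+1})\right|_{\mathbf{x}=0}.$$
   Context: An odd OOSASM triangle of order $n$ is a triangular array $(a_{i,j})_{1\le i\le n,\ i\le j\le 2n-i}$ (row $i$ has entries $a_{i,i},\dots,a_{i,2n-i}$; entries with equal $j$ form a column, the central column being $j=n$) with entries in $\{0,1,-1\}$ such that: (1) for each $j\in\{0,1,\dots,n-1\}$, the non-zero elements of the sequence $a_{1,j},a_{2,j},\dots,a_{j,j},a_{j+1,j+1},a_{j+1,j+2},\dots,a_{j+1,2n-j-1},a_{j,2n-j},a_{j-1,2n-j},\dots,a_{1,2n-j}$ (the first and last parts being empty when $j=0$) alternate in sign and add up to $1$; (2) in the central column the non-zero elements alternate in sign and the top non-zero element (if any) is $1$. A $1$-column is a column whose entries sum to $1$. Columns are re-indexed from left to right by $-n+1,\dots,n-1$ (central column $0$). Operators: $\operatorname{E}_x p(x)=p(x+1)$, $\overline{\Delta}_x=\operatorname{E}_x-\operatorname{Id}$, $\underline{\Delta}_x=\operatorname{Id}-\operatorname{E}_x^{-1}$. For variables $y_1,\dots,y_k$, $M_k(y_1,\dots,y_k)=\prod_{1\le p<q\le k}(1+\overline{\Delta}_{y_q}+\overline{\Delta}_{y_p}\overline{\Delta}_{y_q})\prod_{1\le i<j\le k}\frac{y_j-y_i}{j-i}$. Evaluation "$|_{\mathbf{x}=0}$" means setting all variables to $0$. *)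

theory Defs
  imports Complex_Main
begin

section \<open>Odd OOSASM triangles\<close>

definition alternating :: "int list \<Rightarrow> bool" where
  "alternating xs \<longleftrightarrow> successively (\<lambda>u v. v = - u) (filter (\<lambda>u. u \<noteq> 0) xs)"

definition boundary_path :: "nat \<Rightarrow> (nat \<Rightarrow> nat \<Rightarrow> int) \<Rightarrow> nat \<Rightarrow> int list" where
  "boundary_path n a j =
     map (\<lambda>i. a i j) [1..<j + 1] @
     map (\<lambda>l. a (j + 1) l) [j + 1..<2 * n - j] @
     map (\<lambda>i. a i (2 * n - j)) (rev [1..<j + 1])"

definition central_column :: "nat \<Rightarrow> (nat \<Rightarrow> nat \<Rightarrow> int) \<Rightarrow> int list" where
  "central_column n a = map (\<lambda>i. a i n) [1..<n + 1]"

definition positions :: "nat \<Rightarrow> (nat \<times> nat) set" where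
  "positions n = {(i, j). 1 \<le> i \<and> i \<le> n \<and> i \<le> j \<and> j \<le> 2 * n - i}"

text \<open>
  A triangle is encoded as a function of two indices. It vanishes off the positions, so that
  distinct functions are distinct arrays and triangles can be counted.
\<close>

definition odd_oosasm_triangle :: "nat \<Rightarrow> (nat \<Rightarrow> nat \<Rightarrow> int) \<Rightarrow> bool" where
  "odd_oosasm_triangle n a \<longleftrightarrow>
     (\<forall>i j. (i, j) \<in> positions n \<longrightarrow> a i j \<in> {0, 1, - 1}) \<and>
     (\<forall>i j. (i, j) \<notin> positions n \<longrightarrow> a i j = 0) \<and>
     (\<forall>j<n. alternating (boundary_path n a j) \<and> sum_list (boundary_path n a j) = 1) \<and>
     alternating (central_column n a) \<and>
     (\<forall>u us. filter (\<lambda>u. u \<noteq> 0) (central_column n a) = u # us \<longrightarrow> u = 1)"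

lemma finite_odd_oosasm_triangles: "finite {a. odd_oosasm_triangle n a}"
proof -
  let ?F = "{f :: nat \<times> nat \<Rightarrow> int. \<forall>p. (p \<in> positions n \<longrightarrow> f p \<in> {0, 1, - 1}) \<and>
    (p \<notin> positions n \<longrightarrow> f p = 0)}"
  have "positions n \<subseteq> {..n} \<times> {..2 * n}"
    by (auto simp: positions_def)
  then have "finite (positions n)"
    by (rule finite_subset) simp
  then have "finite ?F"
    by (rule finite_set_of_finite_funs) simp
  moreover have "{a. odd_oosasm_triangle n a} \<subseteq> curry ` ?F"
  proof
    fix a assume "a \<in> {a. odd_oosasm_triangle n a}"
    then have 1: "(i, j) \<in> positions n \<Longrightarrow> a i j \<in> {0, 1, - 1}"
      and 2: "(i, j) \<notin> positions n \<Longrightarrow> a i j = 0" for i j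
      unfolding odd_oosasm_triangle_def by blast+
    have "a = curry (case_prod a)"
      by simp
    moreover have "case_prod a \<in> ?F"
      using 1 2 by (simp add: split_paired_all)
    ultimately show "a \<in> curry ` ?F"
      by (rule image_eqI)
  qed
  ultimately show ?thesis
    by (meson finite_imageI finite_subset)
qed

text \<open>
  The columns of a triangle of order n are numbered - n + 1, ..., n - 1 here, so that column c
  is the one with second index n + c.
\<close>

definition column_sum :: "nat \<Rightarrow> (nat \<Rightarrow> nat \<Rightarrow> int) \<Rightarrow> int \<Rightarrow> int" where
  "column_sum n a c = (\<Sum>i | (i, nat (int n + c)) \<in> positions n. a i (nat (int n + c)))"

definition one_columns :: "nat \<Rightarrow> (nat \<Rightarrow> nat \<Rightarrow> int) \<Rightarrow> int set" where
  "one_columns n a = {c \<in> {- int n + 1..int n - 1}. column_sum n a c = 1}"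

definition num_triangles :: "nat \<Rightarrow> int set \<Rightarrow> nat" where
  "num_triangles n C = card {a. odd_oosasm_triangle n a \<and> one_columns n a = C}"


section \<open>Difference operators and the polynomials M\<close>

text \<open>
  A polynomial in the variables x 1, x 2, ... over the rationals is represented by its
  polynomial function; the operators act on arbitrary functions of the variables.
\<close>

type_synonym mfun = "(nat \<Rightarrow> rat) \<Rightarrow> rat"

definition shift :: "nat \<Rightarrow> rat \<Rightarrow> mfun \<Rightarrow> mfun" where
  "shift i c f = (\<lambda>x. f (x(i := x i + c)))"

definition fdiff :: "nat \<Rightarrow> mfun \<Rightarrow> mfun" where
  "fdiff i f = (\<lambda>x. shift i 1 f x - f x)"

definition bdiff :: "nat \<Rightarrow> mfun \<Rightarrow> mfun" where
  "bdiff i f = (\<lambda>x. f x - shift i (- 1) f x)"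

definition neg_bdiff :: "nat \<Rightarrow> mfun \<Rightarrow> mfun" where
  "neg_bdiff i f = (\<lambda>x. - bdiff i f x)"

definition op_prod :: "(mfun \<Rightarrow> mfun) list \<Rightarrow> mfun \<Rightarrow> mfun" where
  "op_prod As = foldr (\<circ>) As id"

definition pair_op :: "nat \<Rightarrow> nat \<Rightarrow> mfun \<Rightarrow> mfun" where
  "pair_op p q f = (\<lambda>x. f x + fdiff q f x + fdiff p (fdiff q f) x)"

definition vandermonde_quotient :: "nat \<Rightarrow> mfun" where
  "vandermonde_quotient k =
     (\<lambda>x. \<Prod>j\<in>{1..k}. \<Prod>i\<in>{1..<j}. (x j - x i) / (of_nat j - of_nat i))"

text \<open>
  All these operators commute, so the order in which the list enumerates the pairs p < q is
  immaterial.
\<close>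

definition M :: "nat \<Rightarrow> mfun" where
  "M k = op_prod [pair_op p q. q \<leftarrow> [1..<k + 1], p \<leftarrow> [1..<q]] (vandermonde_quotient k)"

lemma shift_commute: "shift i c (shift j d f) = shift j d (shift i c f)"
proof
  fix x
  show "shift i c (shift j d f) x = shift j d (shift i c f) x"
  proof (cases "i = j")
    case True
    then show ?thesis by (simp add: shift_def ac_simps)
  next
    case False
    then have "x(i := x i + c, j := x j + d) = x(j := x j + d, i := x i + c)"
      by (rule fun_upd_twist)
    with False show ?thesis by (simp add: shift_def)
  qed
qed

lemma fdiff_commute: "fdiff i (fdiff j f) = fdiff j (fdiff i f)"
proof
  fix x
  have "shift i 1 (shift j 1 f) x = shift j 1 (shift i 1 f) x"
    by (simp only: shift_commute)
  then show "fdiff i (fdiff j f) x = fdiff j (fdiff i f) x"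
    by (simp add: fdiff_def shift_def)
qed

lemma pair_op_commute: "pair_op p q (pair_op r s f) = pair_op r s (pair_op p q f)"
proof
  fix x
  have add: "fdiff i (\<lambda>x. g x + h x) = (\<lambda>x. fdiff i g x + fdiff i h x)" for i g h
    by (rule ext) (simp add: fdiff_def shift_def)
  have 1: "fdiff q (fdiff s f) = fdiff s (fdiff q f)"
    "fdiff q (fdiff r (fdiff s f)) = fdiff r (fdiff s (fdiff q f))"
    "fdiff p (fdiff q (fdiff s f)) = fdiff s (fdiff p (fdiff q f))"
    "fdiff p (fdiff q (fdiff r (fdiff s f))) = fdiff r (fdiff s (fdiff p (fdiff q f)))"
    by (simp_all only: fdiff_commute[of q s] fdiff_commute[of q r] fdiff_commute[of p s]
        fdiff_commute[of p r])
  show "pair_op p q (pair_op r s f) x = pair_op r s (pair_op p q f) x"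
    unfolding pair_op_def add 1 by (simp add: fdiff_commute[of p s] fdiff_commute[of p r])
qed

end

theory Submission
  imports Defs "Jordan_Normal_Form.Determinant"
begin

text \<open>
  Let A be the set of columns with partial sum 1 after the first i rows. The next row is determined
  by the new set C, and the boundary condition says exactly that a counter, which starts at 1 or 0
  according to whether the column just completed on the left is a 1-column, moves up at the elements
  of C, moves down at the elements of A, and stays in {0, 1}. The right end is symmetric. Hence the
  triangles are counted by a transfer recursion on i.

  This recursion is solved by M. A completed 1-column accounts for two arguments of M, and an
  active column with partial sum 1 for one. Applying a difference operator to all arguments but one
  lowers the number of arguments by one. Scanning a row column by column, each step
  of the counter is either the telescoping f (x + 1) = f x + (difference of f at x), or one use of
  the quadratic relation M (x, x) + M (x + 1, x + 1) = M (x, x + 1) for adjacent arguments. The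
  latter expresses that the product of pair operators times an antisymmetric polynomial becomes
  antisymmetric under an adjacent transposition after multiplication with one more pair operator.
\<close>

section \<open>Newton determinants\<close>

text \<open>The values of \<open>M\<close> are not closed under the recursion: d rows after its last
  entry a 1-column enters through two arguments, differenced d and d - 1 times. So the induction
  runs over all differences of \<open>M\<close> at all points, indexed by lists of orders and
  points. The basis of binomials is chosen because differencing shifts a row of the determinant by
  one place. If every variable but one has been differenced, the constant column has at most one
  non-zero entry and Laplace expansion removes that variable; the pair operators leave behind a unit
  shift of the variables to its right. Read backwards, this lets each row of the triangle insert one
  new variable at a freely chosen point, which the scan then moves across the row. Hence the number
  of arguments equals the number of rows, and this is an invariant of the induction. The scheme
  fails only for the empty list: a fully differenced value vanishes, yet with no arguments at all it
  is 1. The signs of the expansions, -1 for each completed left 1-column, agree with those of the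
  negated backward differences.\<close>

text \<open>
  A list entry (e, x) stands for the e-th forward difference in one variable, evaluated at x; the
  binomials x gchoose (j - e) are the differences of x gchoose j.
\<close>

definition newton :: "nat \<times> rat \<Rightarrow> nat \<Rightarrow> rat" where
  "newton z j = (if j < fst z then 0 else snd z gchoose (j - fst z))"

definition newton_det :: "(nat \<times> rat) list \<Rightarrow> rat" where
  "newton_det zs = det (mat (length zs) (length zs) (\<lambda>(i, j). newton (zs ! i) j))"

lemma newton_add_1: "newton (e, x + 1) j = newton (e, x) j + newton (Suc e, x) j"
proof -
  consider "j < e" | "j = e" | k where "j = Suc (e + k)"
    by (metis less_imp_Suc_add linorder_neqE_nat)
  then show ?thesis
    by cases (auto simp: newton_def gbinomial_Suc_Suc[of x] Suc_diff_le)
qed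

text \<open>Multilinearity in row \<open>t\<close>: the cofactors along that row do not see its
  entries.\<close>

lemma newton_det_update_add:
  assumes t: "t < length zs" and add: "\<And>j. newton z j = newton z1 j + newton z2 j"
  shows "newton_det (zs[t := z]) = newton_det (zs[t := z1]) + newton_det (zs[t := z2])"
proof -
  let ?n = "length zs"
  define A where "A w = mat ?n ?n (\<lambda>(i, j). newton (zs[t := w] ! i) j)" for w
  have carr: "A w \<in> carrier_mat ?n ?n" for w
    by (simp add: A_def)
  have del: "mat_delete (A w) t j = mat_delete (A z) t j" for w j
    by (rule eq_matI) (auto simp: mat_delete_def A_def)
  have "det (A w) = (\<Sum>j<?n. newton w j * cofactor (A z) t j)" for w
    unfolding laplace_expansion_row[OF carr t] cofactor_def del[of w]
    by (rule sum.cong) (auto simp: A_def t)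
  moreover have "newton_det (zs[t := w]) = det (A w)" for w
    by (simp add: newton_det_def A_def)
  ultimately show ?thesis
    by (simp add: add sum.distrib distrib_right)
qed

definition swap_adj :: "nat \<Rightarrow> 'a list \<Rightarrow> 'a list" where
  "swap_adj r zs = zs[r := zs ! Suc r, Suc r := zs ! r]"

lemma length_swap_adj [simp]: "length (swap_adj r zs) = length zs"
  by (simp add: swap_adj_def)

lemma newton_det_swap_adj:
  assumes "Suc r < length zs"
  shows "newton_det (swap_adj r zs) = - newton_det zs"
proof -
  let ?n = "length zs"
  let ?A = "mat ?n ?n (\<lambda>(i, j). newton (zs ! i) j)"
  have "mat ?n ?n (\<lambda>(i, j). newton (swap_adj r zs ! i) j) = swaprows r (Suc r) ?A"
    using assms by (intro eq_matI) (auto simp: swap_adj_def nth_list_update)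
  then show ?thesis
    using assms unfolding newton_det_def length_swap_adj
    by (simp add: det_swaprows[of _ ?n])
qed

text \<open>Column 0 holds the differences of the constant 1, which vanish from order 1 on.\<close>

lemma newton_det_eq_0:
  assumes "zs \<noteq> []" and "\<And>z. z \<in> set zs \<Longrightarrow> 1 \<le> fst z"
  shows "newton_det zs = 0"
proof -
  let ?n = "length zs"
  let ?A = "mat ?n ?n (\<lambda>(i, j). newton (zs ! i) j)"
  have n: "0 < ?n"
    using assms(1) by simp
  have "det ?A = (\<Sum>i<?n. ?A $$ (i, 0) * cofactor ?A i 0)"
    by (rule laplace_expansion_column[OF _ n]) simp
  also have "\<dots> = 0"
  proof (rule sum.neutral, intro ballI)
    fix i assume "i \<in> {..<?n}"
    then have "1 \<le> fst (zs ! i)"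
      using assms(2) nth_mem by blast
    then show "?A $$ (i, 0) * cofactor ?A i 0 = 0"
      using \<open>i \<in> {..<?n}\<close> n by (simp add: newton_def)
  qed
  finally show ?thesis
    by (simp add: newton_det_def)
qed

definition lower :: "nat \<times> rat \<Rightarrow> nat \<times> rat" where
  "lower z = (fst z - 1, snd z)"

definition remove_nth :: "nat \<Rightarrow> 'a list \<Rightarrow> 'a list" where
  "remove_nth p zs = take p zs @ drop (Suc p) zs"

lemma length_remove_nth: "p < length zs \<Longrightarrow> length (remove_nth p zs) = length zs - 1"
  by (simp add: remove_nth_def)

lemma nth_remove_nth:
  assumes "p < length zs"
  shows "remove_nth p zs ! i = zs ! insert_index p i"
  using assms by (auto simp: remove_nth_def nth_append insert_index_def)

text \<open>Entry \<open>p\<close> itself is left free, so that the property survives raising any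
  entry, including \<open>p\<close>; the pair operators raise both kinds.\<close>

definition lifted :: "nat \<Rightarrow> (nat \<times> rat) list \<Rightarrow> bool" where
  "lifted p zs \<longleftrightarrow> p < length zs \<and> (\<forall>t<length zs. t \<noteq> p \<longrightarrow> 1 \<le> fst (zs ! t))"

text \<open>In column 0 only row \<open>p\<close> can be non-zero, which gives the Laplace sign.
  Deleting column 0 shifts the binomial basis by one degree, and \<open>lower\<close> absorbs that
  shift.\<close>

lemma newton_det_remove_nth:
  assumes "lifted p zs"
  shows "newton_det zs =
    (if fst (zs ! p) = 0 then (- 1) ^ p * newton_det (map lower (remove_nth p zs)) else 0)"
proof (cases "fst (zs ! p) = 0")
  case False
  have "1 \<le> fst z" if "z \<in> set zs" for z
    using assms False that by (auto simp: lifted_def in_set_conv_nth Suc_le_eq)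
  moreover have "zs \<noteq> []"
    using assms by (auto simp: lifted_def)
  ultimately show ?thesis
    using newton_det_eq_0 False by auto
next
  case True
  let ?n = "length zs"
  let ?A = "mat ?n ?n (\<lambda>(i, j). newton (zs ! i) j)"
  have p: "p < ?n"
    using assms by (simp add: lifted_def)
  have n: "0 < ?n"
    using p by linarith
  have "det ?A = (\<Sum>i<?n. ?A $$ (i, 0) * cofactor ?A i 0)"
    by (rule laplace_expansion_column[OF _ n]) simp
  also have "\<dots> = (\<Sum>i<?n. if i = p then cofactor ?A p 0 else 0)"
    using assms True n by (intro sum.cong) (auto simp: lifted_def newton_def)
  also have "\<dots> = (- 1) ^ p * det (mat_delete ?A p 0)"
    using p by (simp add: cofactor_def)
  also have "mat_delete ?A p 0 =
    mat (?n - 1) (?n - 1) (\<lambda>(i, j). newton (map lower (remove_nth p zs) ! i) j)"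
  proof (rule eq_matI; simp)
    fix i j assume ij: "i < ?n - Suc 0" "j < ?n - Suc 0"
    have ins: "insert_index p i < ?n" "insert_index p i \<noteq> p"
      using ij by (auto simp: insert_index_def)
    then have 1: "1 \<le> fst (zs ! insert_index p i)"
      using assms by (simp add: lifted_def)
    have "i < length (remove_nth p zs)"
      using p ij by (simp add: length_remove_nth)
    then have "newton (map lower (remove_nth p zs) ! i) j = newton (lower (zs ! insert_index p i)) j"
      by (simp add: nth_remove_nth p)
    also have "\<dots> = newton (zs ! insert_index p i) (Suc j)"
      using 1 by (auto simp: newton_def lower_def)
    finally show "mat_delete ?A p 0 $$ (i, j) = newton (map lower (remove_nth p zs) ! i) j"
      using ij ins by (simp add: mat_delete_def insert_index_def)
  qed
  finally show ?thesis
    using True p by (simp add: newton_det_def length_remove_nth)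
qed

section \<open>The pair operators as raising operators\<close>

text \<open>Out of range the update does nothing, so raisings commute without side conditions, as
  the fold in \<open>raise_pairs\<close> requires.\<close>

definition raise :: "nat \<Rightarrow> (nat \<times> rat) list \<Rightarrow> (nat \<times> rat) list" where
  "raise t zs = zs[t := (Suc (fst (zs ! t)), snd (zs ! t))]"

lemma length_raise [simp]: "length (raise t zs) = length zs"
  by (simp add: raise_def)

lemma nth_raise:
  "i < length zs \<Longrightarrow> raise t zs ! i = (if i = t then (Suc (fst (zs ! t)), snd (zs ! t)) else zs ! i)"
  by (auto simp: raise_def nth_list_update)

lemma raise_commute: "raise p (raise q zs) = raise q (raise p zs)"
  by (rule nth_equalityI) (auto simp: nth_raise)

lemma raise_update:
  "t < length zs \<Longrightarrow>
    raise q (zs[t := (e, x)]) = (if q = t then zs[t := (Suc e, x)] else (raise q zs)[t := (e, x)])"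
  by (rule nth_equalityI) (auto simp: nth_raise nth_list_update)

definition raise_pair ::
    "nat \<Rightarrow> nat \<Rightarrow> ((nat \<times> rat) list \<Rightarrow> rat) \<Rightarrow> (nat \<times> rat) list \<Rightarrow> rat" where
  "raise_pair p q g = (\<lambda>zs. g zs + g (raise q zs) + g (raise p (raise q zs)))"

lemma raise_pair_commute:
  "raise_pair p q (raise_pair r s g) = raise_pair r s (raise_pair p q g)"
  by (simp add: raise_pair_def fun_eq_iff algebra_simps raise_commute)

text \<open>A fold over a set rather than a list, since the pairs will be permuted by a
  transposition and regrouped around a variable that is to be removed.\<close>

definition raise_pairs ::
    "(nat \<times> nat) set \<Rightarrow> ((nat \<times> rat) list \<Rightarrow> rat) \<Rightarrow> (nat \<times> rat) list \<Rightarrow> rat" where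
  "raise_pairs S g = Finite_Set.fold (\<lambda>(p, q). raise_pair p q) g S"

interpretation raise_pair: comp_fun_commute "\<lambda>(p, q). raise_pair p q"
  by unfold_locales (auto simp: fun_eq_iff raise_pair_commute)

lemma raise_pairs_empty [simp]: "raise_pairs {} g = g"
  by (simp add: raise_pairs_def)

lemma raise_pairs_insert:
  "finite S \<Longrightarrow> (p, q) \<notin> S \<Longrightarrow> raise_pairs (insert (p, q) S) g = raise_pair p q (raise_pairs S g)"
  by (simp add: raise_pairs_def)

lemma raise_pairs_Un:
  "finite S \<Longrightarrow> finite T \<Longrightarrow> S \<inter> T = {} \<Longrightarrow> raise_pairs (S \<union> T) g = raise_pairs T (raise_pairs S g)"
  by (simp add: raise_pairs_def raise_pair.fold_set_union_disj)

text \<open>Expresses that raising an order really is differencing in the point. A functional on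
  lists may treat orders and points independently, so this has to be carried through every
  operator.\<close>

definition pascal :: "((nat \<times> rat) list \<Rightarrow> rat) \<Rightarrow> bool" where
  "pascal g \<longleftrightarrow> (\<forall>zs t e x. t < length zs \<longrightarrow>
     g (zs[t := (e, x + 1)]) = g (zs[t := (e, x)]) + g (zs[t := (Suc e, x)]))"

lemma pascal_newton_det: "pascal newton_det"
  by (auto simp: pascal_def intro: newton_det_update_add newton_add_1)

lemma pascal_raise_pair:
  assumes "pascal g"
  shows "pascal (raise_pair p q g)"
  unfolding pascal_def
proof (intro allI impI)
  fix zs :: "(nat \<times> rat) list" and t e x assume "t < length zs"
  then show "raise_pair p q g (zs[t := (e, x + 1)]) =
      raise_pair p q g (zs[t := (e, x)]) + raise_pair p q g (zs[t := (Suc e, x)])"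
    using assms by (auto simp: pascal_def raise_pair_def raise_update)
qed

lemma pascal_raise_pairs: "finite S \<Longrightarrow> pascal g \<Longrightarrow> pascal (raise_pairs S g)"
  by (induction S rule: finite_induct) (auto simp: raise_pairs_insert pascal_raise_pair)

definition index_pairs :: "nat \<Rightarrow> (nat \<times> nat) set" where
  "index_pairs n = {(p, q). p < q \<and> q < n}"

lemma finite_index_pairs [simp]: "finite (index_pairs n)"
  by (rule finite_subset[of _ "{..<n} \<times> {..<n}"]) (auto simp: index_pairs_def)

text \<open>
  If the list zs has entries (e 1, x 1), ..., (e k, x k), then H zs is the value at x of M k after
  e t forward differences in the t-th variable, for every t (see M_eq_H below).
\<close>

definition H :: "(nat \<times> rat) list \<Rightarrow> rat" where
  "H zs = raise_pairs (index_pairs (length zs)) newton_det zs"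

lemma pascal_H: "pascal H"
  using pascal_raise_pairs[OF finite_index_pairs pascal_newton_det]
  by (simp add: pascal_def H_def)

lemma H_add_1: "H (us @ (e, x + 1) # vs) = H (us @ (e, x) # vs) + H (us @ (Suc e, x) # vs)"
proof -
  have "length us < length (us @ (e, x) # vs)"
    by simp
  from pascal_H[unfolded pascal_def, rule_format, OF this, of e x] show ?thesis
    by simp
qed

lemma nth_swap_adj:
  assumes "Suc r < length zs" and "i < length zs"
  shows "swap_adj r zs ! i = zs ! Transposition.transpose r (Suc r) i"
  using assms by (simp add: swap_adj_def nth_list_update Transposition.transpose_def)

lemma raise_swap_adj:
  assumes r: "Suc r < length zs"
  shows "raise p (swap_adj r zs) = swap_adj r (raise (Transposition.transpose r (Suc r) p) zs)"
proof (rule nth_equalityI; simp)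
  fix i assume i: "i < length zs"
  let ?\<tau> = "Transposition.transpose r (Suc r)"
  have "?\<tau> i < length zs"
    using i r by (simp add: Transposition.transpose_def)
  moreover have "?\<tau> i = ?\<tau> p \<longleftrightarrow> i = p"
    by (metis transpose_involutory)
  ultimately show "raise p (swap_adj r zs) ! i = swap_adj r (raise (?\<tau> p) zs) ! i"
    using i r by (auto simp: nth_raise nth_swap_adj)
qed

text \<open>Swapping two entries relabels the positions that the operators raise. It can thus be
  pushed through all of them down to \<open>g\<close>, where it costs a sign.\<close>

lemma raise_pairs_swap_adj:
  fixes r :: nat
  defines "\<tau> \<equiv> Transposition.transpose r (Suc r)"
  assumes "finite S" and g: "\<And>zs. Suc r < length zs \<Longrightarrow> g (swap_adj r zs) = - g zs"
    and "Suc r < length zs"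
  shows "raise_pairs S g (swap_adj r zs) = - raise_pairs (map_prod \<tau> \<tau> ` S) g zs"
  using assms(2,4)
proof (induction S arbitrary: zs)
  case empty
  then show ?case
    by (simp add: g)
next
  case (insert x S)
  obtain p q where x: "x = (p, q)"
    by fastforce
  have inj: "inj (map_prod \<tau> \<tau>)"
    by (simp add: \<tau>_def map_prod_inj_on prod.inj_map)
  have "(\<tau> p, \<tau> q) \<notin> map_prod \<tau> \<tau> ` S"
    using insert.hyps x inj_image_mem_iff[OF inj, of "(p, q)"] by simp
  then show ?case
    using insert unfolding x
    by (simp add: raise_pairs_insert raise_pair_def raise_swap_adj \<tau>_def)
qed

lemma involution_image:
  assumes "\<And>y. f (f y) = y" and "\<And>y. y \<in> S \<Longrightarrow> f y \<in> S"
  shows "f ` S = S"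
proof (intro equalityI subsetI)
  fix y assume "y \<in> S"
  then have "f (f y) \<in> f ` S"
    using assms(2) by blast
  then show "y \<in> f ` S"
    by (simp only: assms(1))
qed (use assms(2) in blast)

text \<open>
  Adjoining the pair (r + 1, r) makes the set of pairs invariant under the transposition, so that
  the resulting function is antisymmetric and vanishes when the two entries agree.
\<close>

lemma H_raise_adj:
  assumes r: "Suc r < length zs" and eq: "zs ! r = zs ! Suc r"
  shows "H zs + H (raise r zs) + H (raise (Suc r) (raise r zs)) = 0"
proof -
  let ?\<tau> = "Transposition.transpose r (Suc r)"
  let ?S = "insert (Suc r, r) (index_pairs (length zs))"
  have "map_prod ?\<tau> ?\<tau> ` ?S = ?S"
  proof -
    have inv: "map_prod ?\<tau> ?\<tau> (map_prod ?\<tau> ?\<tau> y) = y" for y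
      by (cases y) simp
    have "map_prod ?\<tau> ?\<tau> y \<in> ?S" if "y \<in> ?S" for y
      using that r by (cases y) (auto simp: index_pairs_def Transposition.transpose_def)
    then show ?thesis
      using involution_image[OF inv] by blast
  qed
  moreover have "swap_adj r zs = zs"
    unfolding swap_adj_def eq by (metis eq list_update_id)
  ultimately have "raise_pairs ?S newton_det zs = 0"
    using raise_pairs_swap_adj[of ?S r newton_det zs] r newton_det_swap_adj by simp
  moreover have "raise_pairs ?S newton_det =
      raise_pair (Suc r) r (raise_pairs (index_pairs (length zs)) newton_det)"
    by (rule raise_pairs_insert) (simp, simp add: index_pairs_def)
  ultimately show ?thesis
    by (simp add: raise_pair_def H_def)
qed

text \<open>Expanding the differences by \<open>H_add_1\<close> gives the relation M (y, y) + M (y +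
  1, y + 1) = M (y, y + 1) for adjacent arguments.\<close>

lemma H_adjacent:
  "H (us @ (0, y) # (0, y) # vs) + H (us @ (1, y) # (0, y) # vs) + H (us @ (1, y) # (1, y) # vs) = 0"
  using H_raise_adj[of "length us" "us @ (0, y) # (0, y) # vs"]
  by (simp add: raise_def nth_append list_update_append)

section \<open>Eliminating a variable\<close>

definition reduct :: "nat \<Rightarrow> (nat \<times> rat) list \<Rightarrow> (nat \<times> rat) list" where
  "reduct p zs = map lower (remove_nth p zs)"

lemma nth_reduct:
  "p < length zs \<Longrightarrow> i < length zs - 1 \<Longrightarrow> reduct p zs ! i = lower (zs ! insert_index p i)"
  by (simp add: reduct_def length_remove_nth nth_remove_nth)

lemma length_reduct: "p < length zs \<Longrightarrow> length (reduct p zs) = length zs - 1"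
  by (simp add: reduct_def length_remove_nth)

lemma lifted_raise: "lifted p zs \<Longrightarrow> lifted p (raise t zs)"
  by (auto simp: lifted_def nth_raise)

lemma reduct_raise_insert_index:
  assumes "lifted p zs"
  shows "reduct p (raise (insert_index p t) zs) = raise t (reduct p zs)"
proof (rule nth_equalityI)
  have p: "p < length zs"
    using assms by (simp add: lifted_def)
  then show "length (reduct p (raise (insert_index p t) zs)) = length (raise t (reduct p zs))"
    by (simp add: length_reduct)
  fix i assume "i < length (reduct p (raise (insert_index p t) zs))"
  then have i: "i < length zs - 1"
    using p by (simp add: length_reduct)
  then have ins: "insert_index p i < length zs" "insert_index p i \<noteq> p"
    by (auto simp: insert_index_def)
  then have "1 \<le> fst (zs ! insert_index p i)"
    using assms by (simp add: lifted_def)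
  moreover have "insert_index p i = insert_index p t \<longleftrightarrow> i = t"
    by (auto simp: insert_index_def split: if_splits)
  ultimately show "reduct p (raise (insert_index p t) zs) ! i = raise t (reduct p zs) ! i"
    using p i ins by (auto simp: nth_reduct nth_raise length_reduct lower_def prod_eq_iff)
qed

text \<open>
  With a difference in every variable but the p-th, the determinant no longer depends on the p-th
  variable. A pair operator (a, p) then acts as the identity, and (p, b) as the shift of the b-th
  variable by 1.
\<close>

definition reduces ::
    "nat \<Rightarrow> nat \<Rightarrow> ((nat \<times> rat) list \<Rightarrow> rat) \<Rightarrow> ((nat \<times> rat) list \<Rightarrow> rat) \<Rightarrow> bool" where
  "reduces n p g h \<longleftrightarrow> (\<forall>zs. length zs = Suc n \<longrightarrow> lifted p zs \<longrightarrow>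
     g zs = (if fst (zs ! p) = 0 then h (reduct p zs) else 0))"

lemma reducesD:
  "reduces n p g h \<Longrightarrow> length zs = Suc n \<Longrightarrow> lifted p zs \<Longrightarrow>
    g zs = (if fst (zs ! p) = 0 then h (reduct p zs) else 0)"
  by (simp add: reduces_def)

lemma insert_index_neq: "insert_index p a \<noteq> p" "p \<noteq> insert_index p a"
  by (auto simp: insert_index_def)

text \<open>\<open>insert_index p\<close> renumbers the positions that survive the removal of
  \<open>p\<close>; raising those commutes with the reduction.\<close>

lemma reduces_raise_pair:
  assumes "reduces n p g h"
  shows "reduces n p (raise_pair (insert_index p a) (insert_index p b) g) (raise_pair a b h)"
  unfolding reduces_def
proof (intro allI impI)
  fix zs :: "(nat \<times> rat) list" assume zs: "length zs = Suc n" "lifted p zs"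
  then have "p < length zs"
    by (simp add: lifted_def)
  then show "raise_pair (insert_index p a) (insert_index p b) g zs =
      (if fst (zs ! p) = 0 then raise_pair a b h (reduct p zs) else 0)"
    using zs by (simp add: raise_pair_def reducesD[OF assms] lifted_raise nth_raise
        reduct_raise_insert_index insert_index_neq)
qed

text \<open>Both correction terms of the pair operator raise entry \<open>p\<close>, and so they
  vanish.\<close>

lemma reduces_raise_pair_left:
  assumes "reduces n p g h" and "a \<noteq> p"
  shows "reduces n p (raise_pair a p g) h"
  unfolding reduces_def
proof (intro allI impI)
  fix zs :: "(nat \<times> rat) list" assume zs: "length zs = Suc n" "lifted p zs"
  then have "p < length zs"
    by (simp add: lifted_def)
  then show "raise_pair a p g zs = (if fst (zs ! p) = 0 then h (reduct p zs) else 0)"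
    using zs \<open>a \<noteq> p\<close> by (simp add: raise_pair_def reducesD[OF assms(1)] lifted_raise nth_raise)
qed

text \<open>Only the term that raises both entries involves \<open>p\<close> and vanishes. What
  remains, the identity plus a difference, is a unit shift as soon as \<open>h\<close> satisfies
  \<open>pascal\<close>.\<close>

lemma reduces_raise_pair_right:
  assumes "reduces n p g h"
  shows "reduces n p (raise_pair p (insert_index p b) g) (\<lambda>zs. h zs + h (raise b zs))"
  unfolding reduces_def
proof (intro allI impI)
  fix zs :: "(nat \<times> rat) list" assume zs: "length zs = Suc n" "lifted p zs"
  then have "p < length zs"
    by (simp add: lifted_def)
  then show "raise_pair p (insert_index p b) g zs =
      (if fst (zs ! p) = 0 then h (reduct p zs) + h (raise b (reduct p zs)) else 0)"
    using zs by (simp add: raise_pair_def reducesD[OF assms] lifted_raise nth_raise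
        reduct_raise_insert_index insert_index_neq)
qed

lemma reduces_raise_pairs:
  assumes "finite S" and "reduces n p g h"
  shows "reduces n p (raise_pairs (map_prod (insert_index p) (insert_index p) ` S) g) (raise_pairs S h)"
  using assms(1)
proof induction
  case empty
  then show ?case
    by (simp add: assms(2))
next
  case (insert x S)
  obtain a b where x: "x = (a, b)"
    by fastforce
  have "inj (insert_index p)"
    by (rule injI) (auto simp: insert_index_def split: if_splits)
  then have "inj (map_prod (insert_index p) (insert_index p))"
    by (simp add: prod.inj_map)
  then have "(insert_index p a, insert_index p b) \<notin>
      map_prod (insert_index p) (insert_index p) ` S"
    using insert.hyps(2) x inj_image_mem_iff[of _ "(a, b)"] by fastforce
  then show ?case
    using insert reduces_raise_pair by (simp add: x raise_pairs_insert)
qed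

lemma reduces_raise_pairs_left:
  assumes "finite A" and "p \<notin> A" and "reduces n p g h"
  shows "reduces n p (raise_pairs ((\<lambda>a. (a, p)) ` A) g) h"
  using assms(1,2)
proof induction
  case empty
  then show ?case
    by (simp add: assms(3))
next
  case (insert a A)
  then have "(a, p) \<notin> (\<lambda>a. (a, p)) ` A"
    by blast
  then show ?case
    using insert reduces_raise_pair_left by (simp add: raise_pairs_insert)
qed

definition translate :: "nat set \<Rightarrow> (nat \<times> rat) list \<Rightarrow> (nat \<times> rat) list" where
  "translate T zs =
     map (\<lambda>t. (fst (zs ! t), if t \<in> T then snd (zs ! t) + 1 else snd (zs ! t))) [0..<length zs]"

lemma length_translate [simp]: "length (translate T zs) = length zs"
  by (simp add: translate_def)

lemma nth_translate: "t < length zs \<Longrightarrow>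
    translate T zs ! t = (fst (zs ! t), if t \<in> T then snd (zs ! t) + 1 else snd (zs ! t))"
  by (simp add: translate_def)

lemma pascal_translate_insert:
  assumes "pascal h" and "b < length zs" and "b \<notin> T"
  shows "h (translate (insert b T) zs) = h (translate T zs) + h (translate T (raise b zs))"
proof -
  let ?zs = "translate T zs" and ?e = "fst (zs ! b)" and ?x = "snd (zs ! b)"
  have "translate (insert b T) zs = ?zs[b := (?e, ?x + 1)]"
    using assms(2,3) by (intro nth_equalityI) (auto simp: nth_translate nth_list_update)
  moreover have "?zs = ?zs[b := (?e, ?x)]"
    using assms(2,3) by (intro nth_equalityI) (auto simp: nth_translate nth_list_update)
  moreover have "translate T (raise b zs) = ?zs[b := (Suc ?e, ?x)]"
    using assms(2,3) by (intro nth_equalityI) (auto simp: nth_translate nth_list_update nth_raise)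
  ultimately show ?thesis
    using assms(1,2) unfolding pascal_def by (metis length_translate)
qed

lemma reduces_raise_pairs_right:
  assumes "finite T" and "T \<subseteq> {..<n}" and "p \<le> n" and "pascal h" and "reduces n p g h"
  shows "reduces n p (raise_pairs ((\<lambda>b. (p, insert_index p b)) ` T) g) (\<lambda>zs. h (translate T zs))"
  using assms(1,2)
proof induction
  case empty
  have "translate {} zs = zs" for zs
    by (rule nth_equalityI) (auto simp: nth_translate)
  then show ?case
    by (simp add: assms(5))
next
  case (insert b T)
  have notin: "(p, insert_index p b) \<notin> (\<lambda>b. (p, insert_index p b)) ` T"
    using insert.hyps(2) by (auto simp: insert_index_def split: if_splits)
  have "reduces n p (raise_pair p (insert_index p b) (raise_pairs ((\<lambda>b. (p, insert_index p b)) ` T) g))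
      (\<lambda>zs. h (translate T zs) + h (translate T (raise b zs)))"
    using insert by (intro reduces_raise_pair_right) auto
  moreover have "h (translate (insert b T) zs) = h (translate T zs) + h (translate T (raise b zs))"
    if "length zs = n" for zs
    using that insert by (intro pascal_translate_insert assms) auto
  ultimately show ?case
    using notin insert.hyps assms(3)
    by (simp add: raise_pairs_insert reduces_def length_reduct)
qed

text \<open>The three classes are the pairs that avoid \<open>p\<close>, have it second, or have it
  first; they act on the reduct as pair operators, as the identity and as shifts.\<close>

lemma index_pairs_Suc:
  assumes "p \<le> n"
  shows "index_pairs (Suc n) = map_prod (insert_index p) (insert_index p) ` index_pairs n \<union>
    (\<lambda>a. (a, p)) ` {..<p} \<union> (\<lambda>b. (p, insert_index p b)) ` {p..<n}" (is "_ = ?A \<union> ?B \<union> ?C")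
proof (intro equalityI subsetI)
  fix z assume "z \<in> index_pairs (Suc n)"
  then obtain a b where z: "z = (a, b)" and ab: "a < b" "b \<le> n"
    by (auto simp: index_pairs_def)
  consider "b = p" | "a = p" | "a \<noteq> p" "b \<noteq> p"
    by blast
  then show "z \<in> ?A \<union> ?B \<union> ?C"
  proof cases
    case 1
    then show ?thesis
      using z ab by simp
  next
    case 2
    then have "z = (p, insert_index p (b - 1))" "b - 1 \<in> {p..<n}"
      using z ab by (auto simp: insert_index_def)
    then show ?thesis
      by blast
  next
    case 3
    then have "z = map_prod (insert_index p) (insert_index p) (delete_index p a, delete_index p b)"
      by (simp add: z insert_delete_index)
    moreover have "(delete_index p a, delete_index p b) \<in> index_pairs n"
      using 3 ab assms by (auto simp: delete_index_def index_pairs_def)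
    ultimately show ?thesis
      by blast
  qed
next
  fix z assume "z \<in> ?A \<union> ?B \<union> ?C"
  then show "z \<in> index_pairs (Suc n)"
    using assms by (auto simp: index_pairs_def insert_index_def)
qed

text \<open>The sign is that of the Laplace expansion; the translation is the joint effect of the
  pair operators with \<open>p\<close> as first index.\<close>

lemma H_reduct:
  assumes "p < length zs" and "lifted p zs" and "fst (zs ! p) = 0"
  shows "H zs = (- 1) ^ p * H (translate {p..} (reduct p zs))"
proof -
  define n where "n = length zs - 1"
  have n: "length zs = Suc n" "p \<le> n"
    using assms(1) by (auto simp: n_def)
  let ?A = "map_prod (insert_index p) (insert_index p) ` index_pairs n"
    and ?B = "(\<lambda>a. (a, p)) ` {..<p}" and ?C = "(\<lambda>b. (p, insert_index p b)) ` {p..<n}"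
  \<comment> \<open>The sign is built into the base functional, so that it passes through the
    operators by linearity.\<close>
  define h where "h zs = (- 1) ^ p * newton_det zs" for zs
  have pascal_h: "pascal h"
    using pascal_newton_det by (simp add: pascal_def h_def distrib_left)
  have h: "raise_pairs S h zs = (- 1) ^ p * raise_pairs S newton_det zs" if "finite S" for S zs
    using that by (induction S arbitrary: zs)
      (auto simp: h_def raise_pairs_insert raise_pair_def distrib_left)
  have "reduces n p newton_det h"
    by (auto simp: reduces_def h_def newton_det_remove_nth reduct_def)
  then have "reduces n p (raise_pairs ?A newton_det) (raise_pairs (index_pairs n) h)"
    by (intro reduces_raise_pairs) auto
  then have "reduces n p (raise_pairs ?B (raise_pairs ?A newton_det)) (raise_pairs (index_pairs n) h)"
    by (intro reduces_raise_pairs_left) auto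
  then have "reduces n p (raise_pairs ?C (raise_pairs ?B (raise_pairs ?A newton_det)))
      (\<lambda>zs. raise_pairs (index_pairs n) h (translate {p..<n} zs))"
    using n pascal_h by (intro reduces_raise_pairs_right pascal_raise_pairs) auto
  also have "raise_pairs ?C (raise_pairs ?B (raise_pairs ?A newton_det)) =
      raise_pairs (?A \<union> ?B \<union> ?C) newton_det"
  proof -
    have "?A \<inter> ?B = {}" "(?A \<union> ?B) \<inter> ?C = {}"
      by (auto simp: insert_index_def split: if_splits)
    then show ?thesis
      by (simp add: raise_pairs_Un)
  qed
  also have "?A \<union> ?B \<union> ?C = index_pairs (Suc n)"
    using index_pairs_Suc n by simp
  finally have "H zs = raise_pairs (index_pairs n) h (translate {p..<n} (reduct p zs))"
    using assms n by (simp add: reducesD H_def)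
  also have "translate {p..<n} (reduct p zs) = translate {p..} (reduct p zs)"
    using n by (intro nth_equalityI) (auto simp: nth_translate length_reduct)
  finally show ?thesis
    using n by (simp add: h H_def length_reduct)
qed

section \<open>Inserting a dummy variable\<close>

definition up :: "nat \<times> rat \<Rightarrow> nat \<times> rat" where
  "up z = (Suc (fst z), snd z)"

text \<open>Removing a variable translates the entries to its right by 1, so on that side undoing
  \<open>lower\<close> also requires a point that is smaller by 1.\<close>

definition up_back :: "nat \<times> rat \<Rightarrow> nat \<times> rat" where
  "up_back z = (Suc (fst z), snd z - 1)"

text \<open>\<open>H_reduct\<close> read from right to left. The point \<open>x\<close> is free
  because the value no longer depends on it once all other variables are differenced; the row scan
  exploits this freedom.\<close>

lemma H_expand: "H (map up us @ (0, x) # map up_back vs) = (- 1) ^ length us * H (us @ vs)"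
proof -
  let ?zs = "map up us @ (0, x) # map up_back vs" and ?p = "length us"
  have "lifted ?p ?zs"
    by (auto simp: lifted_def nth_append nth_Cons up_def up_back_def split: nat.split)
  moreover have "translate {?p..} (reduct ?p ?zs) = us @ vs"
    by (rule nth_equalityI)
      (auto simp: nth_translate reduct_def remove_nth_def nth_append lower_def up_def up_back_def)
  moreover have "fst (?zs ! ?p) = 0"
    by (simp add: nth_append)
  ultimately show ?thesis
    using H_reduct[of ?p ?zs] by simp
qed

text \<open>Raising keeps all orders positive, so every determinant in the expansion of the
  operators has a zero column. The empty list has the value 1 instead.\<close>

lemma H_eq_0:
  assumes "zs \<noteq> []" and "\<And>z. z \<in> set zs \<Longrightarrow> 1 \<le> fst z"
  shows "H zs = 0"
proof -
  have "raise_pairs S newton_det zs = 0" if "finite S" for S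
    using that assms
  proof (induction S arbitrary: zs)
    case empty
    then show ?case
      by (simp add: newton_det_eq_0)
  next
    case (insert a S)
    have "1 \<le> fst z" if "z \<in> set (raise t ws)" "\<And>z. z \<in> set ws \<Longrightarrow> 1 \<le> fst z" for t z ws
    proof -
      have "z = (Suc (fst (ws ! t)), snd (ws ! t)) \<or> z \<in> set ws"
        using that(1) set_update_subset_insert unfolding raise_def by fast
      then show ?thesis
        using that(2) by (metis One_nat_def Suc_le_mono fst_conv le0)
    qed
    moreover have "raise t ws \<noteq> [] \<longleftrightarrow> ws \<noteq> []" for t ws
      by (simp add: raise_def)
    ultimately show ?case
      using insert by (cases a) (simp add: raise_pairs_insert raise_pair_def)
  qed
  then show ?thesis
    by (simp add: H_def)
qed

section \<open>Expressing M\<close>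

text \<open>The monic multiple of the j-th binomial, built as a \<open>poly\<close> to make degree
  and leading coefficient available.\<close>

definition falling_poly :: "nat \<Rightarrow> rat poly" where
  "falling_poly j = (\<Prod>i<j. [:- of_nat i, 1:])"

lemma poly_falling_poly: "poly (falling_poly j) x = fact j * (x gchoose j)"
  by (simp add: falling_poly_def poly_prod gbinomial_mult_fact lessThan_atLeast0)

lemma degree_falling_poly [simp]: "degree (falling_poly j) = j"
  by (simp add: falling_poly_def degree_prod_sum_eq)

lemma lead_coeff_falling_poly: "coeff (falling_poly j) j = 1"
  using lead_coeff_prod[of "\<lambda>i. [:- rat_of_nat i, 1:]" "{..<j}"]
  by (simp add: falling_poly_def[symmetric])

lemma newton_det_identical:
  assumes "\<not> distinct zs"
  shows "newton_det zs = 0"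
proof -
  obtain i j where ij: "i < length zs" "j < length zs" "i \<noteq> j" "zs ! i = zs ! j"
    using assms by (auto simp: distinct_conv_nth)
  show ?thesis
    unfolding newton_det_def
    by (rule det_identical_rows[OF _ ij(3,1,2)]) (use ij in \<open>auto intro!: eq_vecI\<close>)
qed

text \<open>For distinct \<open>xs\<close> the determinant is a polynomial in \<open>y\<close> of
  degree at most the length m of \<open>xs\<close>, with the elements of \<open>xs\<close> as zeros,
  and its coefficient at degree m is the smaller determinant divided by m!. With a repetition in
  \<open>xs\<close> both sides are 0.\<close>

lemma newton_det_snoc:
  "newton_det (map (Pair 0) (xs @ [y])) =
    newton_det (map (Pair 0) xs) * (\<Prod>p<length xs. (y - xs ! p) / (of_nat (length xs) - of_nat p))"
proof (cases "distinct xs")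
  case False
  then show ?thesis
    by (simp add: newton_det_identical distinct_map)
next
  case True
  define m where "m = length xs"
  define A where "A y = mat (Suc m) (Suc m) (\<lambda>(i, j). newton (map (Pair 0) (xs @ [y]) ! i) j)" for y
  define c where "c j = cofactor (A 0) m j" for j
  have carr: "A y \<in> carrier_mat (Suc m) (Suc m)" for y
    by (simp add: A_def)
  have del: "mat_delete (A y) m j = mat_delete (A 0) m j" for y j
    by (rule eq_matI) (auto simp: mat_delete_def A_def nth_append m_def)
  have row: "newton_det (map (Pair 0) (xs @ [y])) = (\<Sum>j\<le>m. (y gchoose j) * c j)" for y
  proof -
    have "newton_det (map (Pair 0) (xs @ [y])) = det (A y)"
      by (simp add: newton_det_def A_def m_def)
    also have "\<dots> = (\<Sum>j<Suc m. A y $$ (m, j) * cofactor (A y) m j)"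
      by (rule laplace_expansion_row[OF carr]) simp
    also have "\<dots> = (\<Sum>j\<le>m. (y gchoose j) * c j)"
    proof (rule sum.cong)
      fix j assume "j \<in> {..m}"
      then have "A y $$ (m, j) = y gchoose j"
        by (simp add: A_def newton_def m_def nth_append)
      moreover have "cofactor (A y) m j = c j"
        unfolding cofactor_def c_def del[of y] ..
      ultimately show "A y $$ (m, j) * cofactor (A y) m j = (y gchoose j) * c j"
        by simp
    qed auto
    finally show ?thesis .
  qed
  have c_m: "c m = newton_det (map (Pair 0) xs)"
  proof -
    have "mat_delete (A 0) m m = mat m m (\<lambda>(i, j). newton (map (Pair 0) xs ! i) j)"
      by (rule eq_matI) (auto simp: mat_delete_def A_def m_def nth_append)
    then show ?thesis
      by (simp add: c_def cofactor_def newton_det_def m_def flip: mult_2)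
  qed
  \<comment> \<open>\<open>P\<close> is the expansion along the last row, \<open>Q\<close> the
    claimed product. The divisions by factorials turn binomials into monic polynomials.\<close>
  define P where "P = (\<Sum>j\<le>m. smult (c j / fact j) (falling_poly j))"
  define Q where "Q = smult (c m / fact m) (\<Prod>p<m. [:- (xs ! p), 1:])"
  have poly_P: "poly P y = newton_det (map (Pair 0) (xs @ [y]))" for y
    unfolding row P_def by (simp add: poly_sum poly_falling_poly mult.commute)
  have "P = Q"
  proof (rule poly_eqI_degree_lead_coeff[of _ m _ "set xs"])
    have "coeff (falling_poly j) m = (if j = m then 1 else 0)" if "j \<le> m" for j
      using that by (auto simp: lead_coeff_falling_poly intro: coeff_eq_0)
    then have "coeff P m = (\<Sum>j\<le>m. if j = m then c j / fact j else 0)"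
      unfolding P_def coeff_sum by (intro sum.cong) auto
    moreover have "coeff (\<Prod>p<m. [:- (xs ! p), 1:]) m = 1"
      using lead_coeff_prod[of "\<lambda>p. [:- (xs ! p), 1:]" "{..<m}"] by (simp add: degree_prod_sum_eq)
    ultimately show "coeff P m = coeff Q m"
      by (simp add: Q_def)
    show "degree P \<le> m"
      unfolding P_def by (intro degree_sum_le) (auto intro: order.trans[OF degree_smult_le])
    show "degree Q \<le> m"
      unfolding Q_def by (rule order.trans[OF degree_smult_le]) (simp add: degree_prod_sum_eq)
    show "m \<le> card (set xs)"
      using True by (simp add: m_def distinct_card)
    fix z assume "z \<in> set xs"
    then have "\<not> distinct (map (Pair (0::nat)) (xs @ [z]))"
      by (simp add: distinct_map)
    then have "poly P z = 0"
      unfolding poly_P by (rule newton_det_identical)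
    moreover obtain p where "p < m" "xs ! p = z"
      using \<open>z \<in> set xs\<close> by (auto simp: in_set_conv_nth m_def)
    then have "poly Q z = 0"
      by (auto simp: Q_def poly_prod intro!: prod_zero)
    ultimately show "poly P z = poly Q z"
      by simp
  qed
  then have "newton_det (map (Pair 0) (xs @ [y])) = c m / fact m * (\<Prod>p<m. y - xs ! p)"
    using poly_P[of y] by (simp add: Q_def poly_prod)
  moreover have "fact m = (\<Prod>p<m. rat_of_nat m - of_nat p)"
    by (simp add: fact_prod_rev of_nat_diff lessThan_atLeast0)
  ultimately show ?thesis
    by (simp add: c_m prod_dividef flip: m_def)
qed

lemma newton_det_vandermonde:
  "newton_det (map (Pair 0) xs) =
    (\<Prod>q<length xs. \<Prod>p<q. (xs ! q - xs ! p) / (of_nat q - of_nat p))"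
proof (induction xs rule: rev_induct)
  case Nil
  then show ?case
    by (simp add: newton_det_def)
next
  case (snoc y xs)
  have "(\<Prod>q<length xs. \<Prod>p<q. ((xs @ [y]) ! q - (xs @ [y]) ! p) / (of_nat q - of_nat p)) =
      (\<Prod>q<length xs. \<Prod>p<q. (xs ! q - xs ! p) / (of_nat q - of_nat p))"
    by (intro prod.cong) (auto simp: nth_append)
  moreover have "(\<Prod>p<length xs. (y - (xs @ [y]) ! p) / (of_nat (length xs) - of_nat p)) =
      (\<Prod>p<length xs. (y - xs ! p) / (of_nat (length xs) - of_nat p))"
    by (intro prod.cong) (auto simp: nth_append)
  ultimately show ?case
    by (simp only: newton_det_snoc snoc.IH length_append_singleton prod.lessThan_Suc nth_append_length)
qed

section \<open>From operators on functions to raised lists\<close>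

definition points :: "nat \<Rightarrow> (nat \<Rightarrow> nat) \<Rightarrow> (nat \<Rightarrow> rat) \<Rightarrow> (nat \<times> rat) list" where
  "points k e x = map (\<lambda>t. (e t, x t)) [1..<k + 1]"

lemma length_points [simp]: "length (points k e x) = k"
  by (simp add: points_def)

lemma nth_points: "t < k \<Longrightarrow> points k e x ! t = (e (Suc t), x (Suc t))"
  by (simp add: points_def del: upt_Suc)

lemma vandermonde_quotient_eq_newton_det:
  "vandermonde_quotient k x = newton_det (points k (\<lambda>_. 0) x)"
proof -
  have pts: "points k (\<lambda>_. 0) x = map (Pair 0) (map x [1..<k + 1])"
    by (simp add: points_def)
  have "(\<Prod>p<q. (map x [1..<k + 1] ! q - map x [1..<k + 1] ! p) / (of_nat q - of_nat p)) =
      (\<Prod>i\<in>{1..<Suc q}. (x (Suc q) - x i) / (of_nat (Suc q) - of_nat i))" if "q < k" for q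
    using that
    by (intro prod.reindex_bij_witness[of _ "\<lambda>i. i - 1" Suc]) (auto simp del: upt_Suc)
  note eq = this
  have "(\<Prod>q<k. \<Prod>p<q. (map x [1..<k + 1] ! q - map x [1..<k + 1] ! p) / (of_nat q - of_nat p)) =
      (\<Prod>q<k. \<Prod>i\<in>{1..<Suc q}. (x (Suc q) - x i) / (of_nat (Suc q) - of_nat i))"
    by (rule prod.cong[OF refl], rule eq) simp
  also have "\<dots> = vandermonde_quotient k x"
    unfolding vandermonde_quotient_def
    by (rule prod.reindex_bij_witness[of _ "\<lambda>j. j - 1" Suc]) auto
  finally show ?thesis
    unfolding pts newton_det_vandermonde by (simp del: upt_Suc)
qed

lemma points_update:
  "t \<in> {1..k} \<Longrightarrow> points k (e(t := a)) (x(t := b)) = (points k e x)[t - 1 := (a, b)]"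
  by (rule nth_equalityI) (auto simp: nth_points nth_list_update)

lemma raise_points:
  "t \<in> {1..k} \<Longrightarrow> raise (t - 1) (points k e x) = points k (e(t := Suc (e t))) x"
  using points_update[of t k e "Suc (e t)" x "x t"] by (cases t) (simp_all add: raise_def nth_points)

lemma pascal_points:
  assumes "pascal g" and "t \<in> {1..k}"
  shows "g (points k e (x(t := x t + 1))) = g (points k e x) + g (points k (e(t := Suc (e t))) x)"
proof -
  have "t - 1 < length (points k e x)"
    using assms(2) by (cases t) auto
  from assms(1)[unfolded pascal_def, rule_format, OF this, of "e t" "x t"] show ?thesis
    using points_update[OF assms(2), of e "e t" x "x t + 1"] points_update[OF assms(2), of e "e t" x "x t"]
      points_update[OF assms(2), of e "Suc (e t)" x "x t"] by simp
qed

lemma fdiff_points: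
  assumes "pascal g" and "t \<in> {1..k}"
  shows "fdiff t (\<lambda>x. g (points k e x)) = (\<lambda>x. g (points k (e(t := Suc (e t))) x))"
  using pascal_points[OF assms] by (simp add: fdiff_def shift_def fun_eq_iff)

lemma pair_op_points:
  assumes "pascal g" and "p \<in> {1..k}" and "q \<in> {1..k}"
  shows "pair_op p q (\<lambda>x. g (points k e x)) = (\<lambda>x. raise_pair (p - 1) (q - 1) g (points k e x))"
  unfolding pair_op_def fdiff_points[OF assms(1,3)] fdiff_points[OF assms(1,2)] raise_pair_def
    raise_points[OF assms(3)] raise_points[OF assms(2)] ..

lemma op_prod_Cons: "op_prod (A # As) f = A (op_prod As f)"
  by (simp add: op_prod_def)

text \<open>Variables are numbered from 1, list positions from 0. Distinctness makes the fold over
  the set count every factor of the list.\<close>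

lemma op_prod_pairs:
  assumes "distinct ps" and "set ps \<subseteq> {1..k} \<times> {1..k}" and "pascal g"
  shows "op_prod (map (\<lambda>(p, q). pair_op p q) ps) (\<lambda>x. g (points k e x)) =
    (\<lambda>x. raise_pairs ((\<lambda>(p, q). (p - 1, q - 1)) ` set ps) g (points k e x))"
  using assms(1,2)
proof (induction ps)
  case Nil
  then show ?case
    by (simp add: op_prod_def)
next
  case (Cons z ps)
  obtain p q where z: "z = (p, q)"
    by fastforce
  have "(p - 1, q - 1) \<notin> (\<lambda>(p, q). (p - 1, q - 1)) ` set ps"
  proof
    assume "(p - 1, q - 1) \<in> (\<lambda>(p, q). (p - 1, q - 1)) ` set ps"
    then obtain p' q' where pq: "(p', q') \<in> set ps" "p - 1 = p' - 1" "q - 1 = q' - 1"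
      by auto
    then have "1 \<le> p'" "1 \<le> q'" "1 \<le> p" "1 \<le> q"
      using Cons.prems(2) z by auto
    then have "p = p'" "q = q'"
      using pq(2,3) by linarith+
    then show False
      using pq(1) Cons.prems(1) z by simp
  qed
  then show ?case
    using Cons assms(3)
    by (simp add: z op_prod_Cons pair_op_points pascal_raise_pairs raise_pairs_insert)
qed

lemma M_eq_H: "M k = (\<lambda>x. H (points k (\<lambda>_. 0) x))"
proof -
  define ps where "ps = concat (map (\<lambda>q. map (\<lambda>p. (p, q)) [1..<q]) [1..<k + 1])"
  have set_ps: "set ps = {(p, q). 1 \<le> p \<and> p < q \<and> q \<le> k}"
    by (auto simp: ps_def image_iff simp del: upt_Suc)
  have "distinct ps"
    unfolding ps_def
    by (intro distinct_concat) (auto simp: distinct_map inj_on_def simp del: upt_Suc dest!: map_eq_imp_length_eq)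
  moreover have "(\<lambda>(p, q). (p - 1, q - 1)) ` set ps = index_pairs k"
  proof (intro equalityI subsetI)
    fix z assume "z \<in> index_pairs k"
    then show "z \<in> (\<lambda>(p, q). (p - 1, q - 1)) ` set ps"
      unfolding set_ps index_pairs_def
      by (auto intro!: rev_image_eqI[of "(Suc (fst z), Suc (snd z))"])
  qed (auto simp: set_ps index_pairs_def)
  moreover have "M k = op_prod (map (\<lambda>(p, q). pair_op p q) ps) (\<lambda>x. newton_det (points k (\<lambda>_. 0) x))"
    by (simp add: M_def ps_def vandermonde_quotient_eq_newton_det[abs_def] map_concat comp_def del: upt_Suc)
  ultimately show ?thesis
    by (subst (asm) op_prod_pairs) (auto simp: set_ps pascal_newton_det H_def)
qed

section \<open>Powers of differences in single variables\<close>

definition diff_op :: "(nat \<Rightarrow> bool \<times> nat) \<Rightarrow> nat \<Rightarrow> mfun \<Rightarrow> mfun" where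
  "diff_op w t = (if fst (w t) then neg_bdiff t else fdiff t) ^^ snd (w t)"

text \<open>The factor \<open>c\<close> and the offsets \<open>d\<close> are what the operators on
  other variables, applied earlier, leave behind.\<close>

lemma fdiff_power_H:
  assumes "t \<in> {1..k}"
  shows "(fdiff t ^^ s) (\<lambda>x. c * H (points k e (\<lambda>u. x u - d u))) =
    (\<lambda>x. c * H (points k (e(t := e t + s)) (\<lambda>u. x u - d u)))"
proof (induction s)
  case (Suc s)
  show ?case
  proof
    fix x :: "nat \<Rightarrow> rat"
    let ?e = "e(t := e t + s)" and ?y = "\<lambda>u. x u - d u"
    have 1: "(\<lambda>u. (x(t := x t + 1)) u - d u) = ?y(t := ?y t + 1)"
      by auto
    have 2: "e(t := e t + Suc s) = ?e(t := Suc (?e t))"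
      by auto
    have "(fdiff t ^^ Suc s) (\<lambda>x. c * H (points k e (\<lambda>u. x u - d u))) x =
      fdiff t (\<lambda>x. c * H (points k ?e (\<lambda>u. x u - d u))) x"
      by (simp only: Suc funpow.simps comp_def)
    also have "\<dots> = c * (H (points k ?e (\<lambda>u. (x(t := x t + 1)) u - d u)) - H (points k ?e ?y))"
      by (simp add: fdiff_def shift_def algebra_simps)
    also have "H (points k ?e (\<lambda>u. (x(t := x t + 1)) u - d u)) - H (points k ?e ?y) =
        H (points k (e(t := e t + Suc s)) ?y)"
      unfolding 1 2 by (subst pascal_points[OF pascal_H assms]) simp
    finally show "(fdiff t ^^ Suc s) (\<lambda>x. c * H (points k e (\<lambda>u. x u - d u))) x =
        c * H (points k (e(t := e t + Suc s)) ?y)" .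
  qed
qed simp

text \<open>The backward difference at x is the forward difference at x - 1. Each application
  therefore raises the order, moves the point back by 1 and changes the sign.\<close>

lemma neg_bdiff_power_H:
  assumes "t \<in> {1..k}"
  shows "(neg_bdiff t ^^ s) (\<lambda>x. c * H (points k e (\<lambda>u. x u - d u))) =
    (\<lambda>x. (- 1) ^ s * c * H (points k (e(t := e t + s)) (\<lambda>u. x u - (d(t := d t + of_nat s)) u)))"
proof (induction s)
  case (Suc s)
  show ?case
  proof
    fix x :: "nat \<Rightarrow> rat"
    let ?d = "d(t := d t + of_nat s)" and ?e = "e(t := e t + s)"
    let ?y = "\<lambda>u. x u - (d(t := d t + of_nat (Suc s))) u"
    have 1: "(\<lambda>u. x u - ?d u) = ?y(t := ?y t + 1)"
      by auto
    have 2: "(\<lambda>u. (x(t := x t - 1)) u - ?d u) = ?y"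
      by auto
    have 3: "e(t := e t + Suc s) = ?e(t := Suc (?e t))"
      by auto
    have "(neg_bdiff t ^^ Suc s) (\<lambda>x. c * H (points k e (\<lambda>u. x u - d u))) x =
      neg_bdiff t (\<lambda>x. (- 1) ^ s * c * H (points k ?e (\<lambda>u. x u - ?d u))) x"
      by (simp only: Suc funpow.simps comp_def)
    also have "\<dots> = (- 1) ^ Suc s * c * (H (points k ?e (\<lambda>u. x u - ?d u)) -
        H (points k ?e (\<lambda>u. (x(t := x t - 1)) u - ?d u)))"
      by (simp add: neg_bdiff_def bdiff_def shift_def algebra_simps)
    also have "H (points k ?e (\<lambda>u. x u - ?d u)) - H (points k ?e (\<lambda>u. (x(t := x t - 1)) u - ?d u)) =
        H (points k (e(t := e t + Suc s)) ?y)"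
      unfolding 1 2 3 by (subst pascal_points[OF pascal_H assms]) simp
    finally show "(neg_bdiff t ^^ Suc s) (\<lambda>x. c * H (points k e (\<lambda>u. x u - d u))) x =
        (- 1) ^ Suc s * c * H (points k (e(t := e t + Suc s)) ?y)" .
  qed
qed simp

lemma op_prod_diff_op:
  assumes "distinct ts" and "set ts \<subseteq> {1..k}"
  shows "op_prod (map (diff_op w) ts) (M k) =
    (\<lambda>x. (\<Prod>t\<in>set ts. if fst (w t) then (- 1) ^ snd (w t) else 1) *
      H (points k (\<lambda>t. if t \<in> set ts then snd (w t) else 0)
        (\<lambda>t. x t - (if t \<in> set ts \<and> fst (w t) then of_nat (snd (w t)) else 0))))"
  using assms
proof (induction ts)
  case Nil
  then show ?case
    by (simp add: op_prod_def M_eq_H)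
next
  case (Cons t ts)
  let ?e = "\<lambda>ts t. if t \<in> set ts then snd (w t) else 0"
    and ?d = "\<lambda>ts t. if t \<in> set ts \<and> fst (w t) then rat_of_nat (snd (w t)) else 0"
  have t: "t \<in> {1..k}"
    using Cons.prems by simp
  have e: "?e (t # ts) = (?e ts)(t := ?e ts t + snd (w t))"
    using Cons.prems by auto
  show ?case
  proof (cases "fst (w t)")
    case True
    then have d: "(if u = t then rat_of_nat (snd (w t))
        else if u \<in> set ts \<and> fst (w u) then of_nat (snd (w u)) else 0) =
      (if (u = t \<or> u \<in> set ts) \<and> fst (w u) then of_nat (snd (w u)) else 0)" for u
      by auto
    show ?thesis
      using Cons True unfolding e
      by (simp add: op_prod_Cons diff_op_def neg_bdiff_power_H[OF t, of _ _ "?e ts" "?d ts"] mult.assoc d)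
  next
    case False
    then have d: "(u = t \<or> u \<in> set ts) \<and> fst (w u) \<longleftrightarrow> u \<in> set ts \<and> fst (w u)" for u
      by auto
    show ?thesis
      using Cons False unfolding e
      by (simp add: op_prod_Cons diff_op_def fdiff_power_H[OF t, of _ _ "?e ts" "?d ts"] d)
  qed
qed

text \<open>This brings the operator formula into the shape that the row recursion reaches after its
  last row.\<close>

lemma op_prod_diff_op_at_0:
  "op_prod (map (diff_op w) [1..<k + 1]) (M k) (\<lambda>_. 0) =
    (\<Prod>t\<in>{1..k}. if fst (w t) then (- 1) ^ snd (w t) else 1) *
    H (map (\<lambda>t. (snd (w t), if fst (w t) then - of_nat (snd (w t)) else 0)) [1..<k + 1])"
proof -
  have "set [1..<k + 1] = {1..k}"
    by auto
  moreover have "points k (\<lambda>t. if t \<in> {1..k} then snd (w t) else 0)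
      (\<lambda>t. 0 - (if t \<in> {1..k} \<and> fst (w t) then of_nat (snd (w t)) else 0)) =
    map (\<lambda>t. (snd (w t), if fst (w t) then - of_nat (snd (w t)) else 0)) [1..<k + 1]"
    unfolding points_def by (rule map_cong) auto
  ultimately show ?thesis
    by (subst op_prod_diff_op[of _ k]) (simp_all only: distinct_upt order.refl)
qed

section \<open>Scanning a row\<close>

text \<open>With \<open>B\<close> the old and \<open>C\<close> the new state, the summand is the row
  entry in column l; \<open>s\<close> is the sum collected in the left column before the path enters
  the row.\<close>

definition walk_state :: "nat \<Rightarrow> int \<Rightarrow> nat set \<Rightarrow> nat set \<Rightarrow> nat \<Rightarrow> int" where
  "walk_state i s C B c = s + (\<Sum>l\<in>{i<..c}. of_bool (l \<in> C) - of_bool (l \<in> B))"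

definition walks :: "nat \<Rightarrow> int \<Rightarrow> nat set \<Rightarrow> nat \<Rightarrow> int \<Rightarrow> nat set set" where
  "walks i s C e t =
     {B. B \<subseteq> {i<..e} \<and> (\<forall>c\<in>{i..e}. walk_state i s C B c \<in> {0, 1}) \<and> walk_state i s C B e = t}"

lemma finite_walks: "finite (walks i s C e t)"
  by (rule finite_subset[of _ "Pow {i<..e}"]) (auto simp: walks_def)

lemma walks_same: "walks i s C i t = (if s = t \<and> s \<in> {0, 1} then {{}} else {})"
  by (auto simp: walks_def walk_state_def)

lemma walks_outside: "i \<le> e \<Longrightarrow> t \<notin> {0, 1} \<Longrightarrow> walks i s C e t = {}"
  by (auto simp: walks_def)

lemma walk_state_Suc:
  assumes "i \<le> e"
  shows "walk_state i s C B (Suc e) =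
    walk_state i s C B e + of_bool (Suc e \<in> C) - of_bool (Suc e \<in> B)"
proof -
  have "{i<..Suc e} = insert (Suc e) {i<..e}"
    using assms by auto
  then show ?thesis
    by (simp add: walk_state_def)
qed

lemma walk_state_cong:
  "(\<And>l. i < l \<Longrightarrow> l \<le> c \<Longrightarrow> l \<in> B \<longleftrightarrow> l \<in> B') \<Longrightarrow> walk_state i s C B c = walk_state i s C B' c"
  unfolding walk_state_def by (intro arg_cong2[of _ _ _ _ "(+)"] refl sum.cong) auto

text \<open>Only the membership of the last column in \<open>B\<close> is open, and either choice
  determines the counter before that column.\<close>

lemma walks_Suc:
  assumes "i \<le> e" and "t \<in> {0, 1}"
  shows "walks i s C (Suc e) t = walks i s C e (t - of_bool (Suc e \<in> C)) \<union>
    insert (Suc e) ` walks i s C e (t - of_bool (Suc e \<in> C) + 1)" (is "?L = ?R0 \<union> ?R1")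
proof (intro equalityI subsetI)
  fix B assume B: "B \<in> ?L"
  define B' where "B' = B - {Suc e}"
  have st: "walk_state i s C B' c = walk_state i s C B c" if "c \<le> e" for c
    by (rule walk_state_cong) (use that in \<open>auto simp: B'_def\<close>)
  have sub: "B' \<subseteq> {i<..e}"
    using B by (auto simp: walks_def B'_def le_Suc_eq)
  have "B' \<in> walks i s C e (t - of_bool (Suc e \<in> C) + of_bool (Suc e \<in> B))"
    using B assms sub by (auto simp: walks_def st walk_state_Suc)
  moreover have "B = (if Suc e \<in> B then insert (Suc e) B' else B')"
    by (auto simp: B'_def)
  ultimately show "B \<in> ?R0 \<union> ?R1"
    by (cases "Suc e \<in> B") auto
next
  fix B assume "B \<in> ?R0 \<union> ?R1"
  then have "\<exists>B'. B' \<in> walks i s C e (t - of_bool (Suc e \<in> C) + of_bool (Suc e \<in> B)) \<and>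
      B = (if Suc e \<in> B then insert (Suc e) B' else B')"
  proof (elim UnE imageE)
    assume "B \<in> ?R0"
    moreover from this have "Suc e \<notin> B"
      by (auto simp: walks_def)
    ultimately show ?thesis
      by (intro exI[of _ B]) simp
  next
    fix B' assume "B = insert (Suc e) B'" "B' \<in> walks i s C e (t - of_bool (Suc e \<in> C) + 1)"
    then show ?thesis
      by (intro exI[of _ B']) simp
  qed
  then obtain B' where B': "B' \<in> walks i s C e (t - of_bool (Suc e \<in> C) + of_bool (Suc e \<in> B))"
    and B: "B = (if Suc e \<in> B then insert (Suc e) B' else B')"
    by blast
  have st: "walk_state i s C B c = walk_state i s C B' c" if "c \<le> e" for c
    by (rule walk_state_cong) (use that B in \<open>auto split: if_splits\<close>)
  have "B \<subseteq> {i<..Suc e}"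
    using B B' assms(1) by (auto simp: walks_def split: if_splits)
  moreover have "walk_state i s C B c \<in> {0, 1}" if "c \<in> {i..e}" for c
    using B' that by (simp add: walks_def st)
  moreover have "walk_state i s C B (Suc e) = t"
    using B' assms(1) by (simp add: walks_def st walk_state_Suc)
  ultimately have "walk_state i s C B c \<in> {0, 1}" if "c \<in> {i..Suc e}" for c
    using assms that by (cases "c = Suc e") auto
  with \<open>B \<subseteq> {i<..Suc e}\<close> \<open>walk_state i s C B (Suc e) = t\<close> show "B \<in> ?L"
    by (simp add: walks_def)
qed

lemma sum_walks_Suc:
  assumes "i \<le> e" and "t \<in> {0, 1}"
  shows "(\<Sum>B\<in>walks i s C (Suc e) t. g B) =
    (\<Sum>B\<in>walks i s C e (t - of_bool (Suc e \<in> C)). g B) +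
    (\<Sum>B\<in>walks i s C e (t - of_bool (Suc e \<in> C) + 1). g (insert (Suc e) B))"
proof -
  have notin: "Suc e \<notin> B" if "B \<in> walks i s C e t" for B t
    using that by (auto simp: walks_def)
  have "inj_on (insert (Suc e)) (walks i s C e t)" for t
    by (rule inj_onI) (metis Diff_insert_absorb notin)
  then show ?thesis
    unfolding walks_Suc[OF assms]
    by (subst sum.union_disjoint) (auto simp: finite_walks sum.reindex dest: notin)
qed

definition singles :: "(nat \<Rightarrow> rat) \<Rightarrow> nat \<Rightarrow> nat \<Rightarrow> nat set \<Rightarrow> (nat \<times> rat) list" where
  "singles x i e B = map (\<lambda>c. (0, x c)) (filter (\<lambda>c. c \<in> B) [Suc i..<Suc e])"

lemma singles_same [simp]: "singles x i i B = []"
  by (simp add: singles_def)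

lemma singles_Suc:
  "i \<le> e \<Longrightarrow> singles x i (Suc e) B = singles x i e B @ (if Suc e \<in> B then [(0, x (Suc e))] else [])"
  by (simp add: singles_def)

lemma singles_cong:
  "(\<And>l. i < l \<Longrightarrow> l \<le> e \<Longrightarrow> l \<in> B \<longleftrightarrow> l \<in> B') \<Longrightarrow> singles x i e B = singles x i e B'"
  unfolding singles_def by (rule arg_cong[where f = "map _"], rule filter_cong) auto

text \<open>Ties the counter to numbers of arguments; this will show that a row adds exactly one
  argument.\<close>

lemma length_singles:
  assumes "i \<le> e"
  shows "walk_state i s C B e = s + int (length (singles x i e C)) - int (length (singles x i e B))"
  using assms
  by (induction rule: dec_induct) (simp_all add: walk_state_Suc singles_Suc, simp add: walk_state_def)

text \<open>The quadratic relation with the difference in the second argument written out. It serves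
  columns lying in both the old and the new state that are passed with counter 0.\<close>

lemma H_step:
  "H (us @ (0, x) # (1, x) # vs) = H (us @ (0, x + 1) # (0, x + 1) # vs)"
  using H_adjacent[of us x vs] H_add_1[of us 0 x "(0, x + 1) # vs"]
    H_add_1[of "us @ [(0, x)]" 0 x vs] H_add_1[of "us @ [(1, x)]" 0 x vs] by simp

text \<open>A descent by 1 between neighbours is, up to sign, a difference in both. It vanishes when
  the remaining entries are differenced as well.\<close>

lemma H_descent: "H (us @ (0, x + 1) # (0, x) # vs) = - H (us @ (1, x) # (1, x) # vs)"
  using H_adjacent[of us x vs] H_add_1[of us 0 x "(0, x) # vs"] by simp

text \<open>The invariant of the scan: counter 0 means that an extra undifferenced entry sits at the
  current column, counter 1 that there is none. The last two hypotheses are the invariant at the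
  start. \<open>ys\<close> must stay arbitrary, because a column put into the old state joins the
  entries to the right of the scan.\<close>

lemma sum_walks_H_induct:
  assumes "i \<le> e" and x: "\<And>c. x (Suc c) = x c + 1"
    and "\<And>ys. P @ ys \<noteq> [] \<Longrightarrow>
      (\<Sum>B\<in>walks i s C i 1. H (L @ ys)) = \<kappa> * H (P @ map up_back ys)"
    and "\<And>ys. (\<Sum>B\<in>walks i s C i 0. H (L @ ys)) = \<kappa> * H (P @ (0, x i) # map up_back ys)"
  shows "P @ singles x i e C @ ys \<noteq> [] \<Longrightarrow> (\<Sum>B\<in>walks i s C e 1. H (L @ singles x i e B @ ys)) =
      \<kappa> * H (P @ singles x i e C @ map up_back ys)" (is "PROP ?P1 e ys")
    and "(\<Sum>B\<in>walks i s C e 0. H (L @ singles x i e B @ ys)) =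
      \<kappa> * H (P @ singles x i e C @ (0, x e) # map up_back ys)" (is "?P0 e ys")
proof -
  have "(P @ singles x i e C @ ys \<noteq> [] \<longrightarrow> (\<Sum>B\<in>walks i s C e 1. H (L @ singles x i e B @ ys)) =
      \<kappa> * H (P @ singles x i e C @ map up_back ys)) \<and>
    (\<Sum>B\<in>walks i s C e 0. H (L @ singles x i e B @ ys)) =
      \<kappa> * H (P @ singles x i e C @ (0, x e) # map up_back ys)"
    using assms(1)
  proof (induction arbitrary: ys rule: dec_induct)
    case base
    then show ?case
      using assms(3,4) by simp
  next
    case (step e)
    let ?z = "(0, x (Suc e))"
    note ie = \<open>i \<le> e\<close>
    have out: "singles x i (Suc e) B = singles x i e B"
      and ins: "singles x i (Suc e) (insert (Suc e) B) = singles x i e B @ [?z]"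
      if "B \<in> walks i s C e t" for B t
    proof -
      have "Suc e \<notin> B"
        using that by (auto simp: walks_def)
      then show "singles x i (Suc e) B = singles x i e B"
        by (simp add: singles_Suc ie)
      have "singles x i e (insert (Suc e) B) = singles x i e B"
        by (rule singles_cong) auto
      then show "singles x i (Suc e) (insert (Suc e) B) = singles x i e B @ [?z]"
        by (simp add: singles_Suc ie)
    qed
    have sum: "(\<Sum>B\<in>walks i s C (Suc e) t. H (L @ singles x i (Suc e) B @ ys)) =
        (\<Sum>B\<in>walks i s C e (t - of_bool (Suc e \<in> C)). H (L @ singles x i e B @ ys)) +
        (\<Sum>B\<in>walks i s C e (t - of_bool (Suc e \<in> C) + 1). H (L @ singles x i e B @ ?z # ys))"
      if "t \<in> {0, 1}" for t
      unfolding sum_walks_Suc[OF ie that]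
      by (intro arg_cong2[of _ _ _ _ "(+)"] sum.cong refl) (simp_all add: out ins)
    note sum1 = sum[OF insertI2[OF singletonI]] and sum0 = sum[OF insertI1]
    have IH1: "P @ singles x i e C @ ys \<noteq> [] \<Longrightarrow> (\<Sum>B\<in>walks i s C e 1. H (L @ singles x i e B @ ys)) =
        \<kappa> * H (P @ singles x i e C @ map up_back ys)"
      and IH0: "(\<Sum>B\<in>walks i s C e 0. H (L @ singles x i e B @ ys)) =
        \<kappa> * H (P @ singles x i e C @ (0, x e) # map up_back ys)" for ys
      using step.IH by blast+
    have z: "up_back ?z = (1, x e)"
      by (simp add: up_back_def x)
    \<comment> \<open>The extra entry advances by one column: the two choices for the membership of
      \<open>Suc e\<close> in the old state supply the two terms of Pascal's rule.\<close>
    have move: "H ((P @ singles x i e C) @ (0, x e) # map up_back ys) +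
        H ((P @ singles x i e C) @ up_back ?z # map up_back ys) =
        H ((P @ singles x i e C) @ ?z # map up_back ys)"
      unfolding z unfolding x using H_add_1[of "P @ singles x i e C" 0 "x e" "map up_back ys"] by simp
    show ?case
    proof (cases "Suc e \<in> C")
      case True
      \<comment> \<open>Counter 0 after a column of \<open>C\<close>: the old state must contain
        this column too, as the counter cannot come from -1. With a single choice left, the
        quadratic relation takes over from Pascal's rule.\<close>
      have "\<kappa> * H ((P @ singles x i e C) @ (0, x e) # up_back ?z # map up_back ys) =
          \<kappa> * H ((P @ singles x i e C) @ ?z # ?z # map up_back ys)"
        unfolding z unfolding x H_step ..
      moreover have "walks i s C e (- 1) = {}"
        using ie by (intro walks_outside) auto
      ultimately show ?thesis
        unfolding sum1 sum0
        using True move IH0[of ys] IH1[of "?z # ys"] IH0[of "?z # ys"]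
        by (simp add: singles_Suc ie flip: distrib_left)
    next
      case False
      moreover have "walks i s C e 2 = {}"
        using ie by (intro walks_outside) auto
      ultimately show ?thesis
        unfolding sum1 sum0
        using move IH0[of ys] IH1[of "?z # ys"] IH1[of ys]
        by (simp add: singles_Suc ie flip: distrib_left)
    qed
  qed
  then show "PROP ?P1 e ys" "?P0 e ys"
    by simp_all
qed

text \<open>\<open>H_expand\<close> inserts the new variable at column i if \<open>s\<close> is 0
  and at column i + 1 if \<open>s\<close> is 1. The latter point is chosen so that the case that has
  to vanish becomes a descent. For end value 1 the empty list is excluded: there is no walk from 0,
  but \<open>H []\<close> is 1.\<close>

lemma sum_walks_H:
  fixes L :: "(nat \<times> rat) list"
  assumes ie: "i \<le> e" and x: "\<And>c. x (Suc c) = x c + 1" and s: "s \<in> {0, 1}"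
  defines "P \<equiv> map up L @ (if s = 1 then [(0, x (Suc i))] else [])"
  shows "P @ singles x i e C @ ys \<noteq> [] \<Longrightarrow> (\<Sum>B\<in>walks i s C e 1. H (L @ singles x i e B @ ys)) =
      (- 1) ^ length L * H (P @ singles x i e C @ map up_back ys)"
    and "(\<Sum>B\<in>walks i s C e 0. H (L @ singles x i e B @ ys)) =
      (- 1) ^ length L * H (P @ singles x i e C @ (0, x e) # map up_back ys)"
proof -
  have sgn: "(- 1) ^ length L * ((- 1) ^ length L * r) = r" for r :: rat
    by (simp flip: mult.assoc power_mult_distrib)
  have 1: "(\<Sum>B\<in>walks i s C i 1. H (L @ ys)) = (- 1) ^ length L * H (P @ map up_back ys)"
    if "P @ ys \<noteq> []" for ys
  proof (cases "s = 1")
    case True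
    then show ?thesis
      by (simp add: walks_same P_def H_expand sgn)
  next
    case False
    \<comment> \<open>No empty walk leads from 0 to 1; correspondingly, all entries are
      differenced.\<close>
    then have "H (P @ map up_back ys) = 0"
      using that by (intro H_eq_0) (auto simp: P_def up_def up_back_def)
    then show ?thesis
      using False by (simp add: walks_same)
  qed
  have 0: "(\<Sum>B\<in>walks i s C i 0. H (L @ ys)) =
      (- 1) ^ length L * H (P @ (0, x i) # map up_back ys)" for ys
  proof (cases "s = 1")
    case True
    \<comment> \<open>No empty walk leads from 1 to 0, and the right-hand side is a descent from
      \<open>x i + 1\<close> to \<open>x i\<close>.\<close>
    have "H (map up L @ (1, x i) # (1, x i) # map up_back ys) = 0"
      by (rule H_eq_0) (auto simp: up_def up_back_def)
    then show ?thesis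
      using True by (simp add: walks_same P_def x H_descent)
  next
    case False
    then show ?thesis
      using s by (simp add: walks_same P_def H_expand sgn)
  qed
  show "P @ singles x i e C @ ys \<noteq> [] \<Longrightarrow> (\<Sum>B\<in>walks i s C e 1. H (L @ singles x i e B @ ys)) =
      (- 1) ^ length L * H (P @ singles x i e C @ map up_back ys)"
    by (rule sum_walks_H_induct(1)[OF ie x 1 0])
  show "(\<Sum>B\<in>walks i s C e 0. H (L @ singles x i e B @ ys)) =
      (- 1) ^ length L * H (P @ singles x i e C @ (0, x e) # map up_back ys)"
    by (rule sum_walks_H_induct(2)[OF ie x 1 0])
qed

section \<open>The transfer recursion\<close>

text \<open>
  The columns outside the current row do not change, so that the old state is C outside the row and
  some walk B inside.
\<close>

fun num_states :: "nat \<Rightarrow> nat \<Rightarrow> nat set \<Rightarrow> nat" where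
  "num_states n 0 C = of_bool (C = {})"
| "num_states n (Suc i) C =
     (\<Sum>B\<in>walks i (of_bool (i \<in> C)) C (2 * n - Suc i) (1 - of_bool (2 * n - i \<in> C)).
       num_states n i ((C - {i<..2 * n - Suc i}) \<union> B))"

definition column :: "nat \<Rightarrow> nat \<Rightarrow> rat" where
  "column n c = of_nat c - of_nat n"

lemma column_Suc: "column n (Suc c) = column n c + 1"
  by (simp add: column_def)

text \<open>
  The operator for a left 1-column is a power of the negated backward difference, which is up to sign
  a power of the forward difference at a shifted point; this keeps the points of left columns fixed
  while the points of right columns move with the row. The natural subtractions are never truncated.
\<close>

definition left_part :: "nat \<Rightarrow> nat \<Rightarrow> nat set \<Rightarrow> (nat \<times> rat) list" where
  "left_part n i A = concat (map (\<lambda>c. [(i - c, column n c), (i - Suc c, column n (Suc c))])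
     (filter (\<lambda>c. c \<in> A) [1..<i]))"

definition right_part :: "nat \<Rightarrow> nat \<Rightarrow> nat set \<Rightarrow> (nat \<times> rat) list" where
  "right_part n i A = concat (map (\<lambda>c. [(c - Suc (2 * n - i), column n (2 * n - i)),
     (c - (2 * n - i), column n (2 * n - i))]) (filter (\<lambda>c. c \<in> A) [Suc (2 * n - i)..<2 * n]))"

definition optional :: "nat \<Rightarrow> nat \<Rightarrow> nat set \<Rightarrow> (nat \<times> rat) list" where
  "optional n c A = (if c \<in> A then [(0, column n c)] else [])"

text \<open>Columns i and 2n - i have just received their last entry but still count once; they are
  doubled when the next row is scanned.\<close>

definition state_points :: "nat \<Rightarrow> nat \<Rightarrow> nat set \<Rightarrow> (nat \<times> rat) list" where
  "state_points n i A = left_part n i A @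
     map (\<lambda>c. (0, column n c)) (filter (\<lambda>c. c \<in> A) [i..<Suc (2 * n - i)]) @ right_part n i A"

lemma state_points_split:
  assumes "i < n"
  shows "state_points n i A = left_part n i A @ optional n i A @
    singles (column n) i (2 * n - Suc i) A @ optional n (2 * n - i) A @ right_part n i A"
proof -
  have e: "2 * n - i = Suc (2 * n - Suc i)"
    using assms by simp
  have "[i..<Suc (2 * n - i)] = i # [Suc i..<Suc (2 * n - Suc i)] @ [2 * n - i]"
    using assms unfolding e by (simp add: upt_conv_Cons)
  then show ?thesis
    by (simp add: state_points_def singles_def optional_def del: upt_Suc)
qed

text \<open>A 1-column i becomes a pair: its own entry, raised, and the variable inserted at column
  i + 1 for a scan that starts with counter 1.\<close>

lemma left_part_Suc:
  assumes "0 \<notin> A"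
  shows "left_part n (Suc i) A = map up (left_part n i A @ optional n i A) @
    (if i \<in> A then [(0, column n (Suc i))] else [])"
proof (cases "i = 0")
  case True
  then show ?thesis
    using assms by (simp add: left_part_def optional_def)
next
  case False
  have "concat (map (\<lambda>c. [(Suc i - c, column n c), (Suc i - Suc c, column n (Suc c))])
      (filter (\<lambda>c. c \<in> A) [1..<i])) =
    concat (map (\<lambda>c. map up [(i - c, column n c), (i - Suc c, column n (Suc c))])
      (filter (\<lambda>c. c \<in> A) [1..<i]))"
    by (intro arg_cong[where f = concat] map_cong refl) (auto simp: up_def)
  then show ?thesis
    using False by (simp add: left_part_def optional_def map_concat comp_def up_def)
qed

text \<open>The new partner of column 2n - i is the extra entry that remains at the end of the row
  when the scan stops with counter 0.\<close>

lemma right_part_Suc: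
  assumes "i < n" and "A \<subseteq> {1..<2 * n}"
  shows "right_part n (Suc i) A =
    (if 2 * n - i \<in> A then [(0, column n (2 * n - Suc i))] else []) @
    map up_back (optional n (2 * n - i) A @ right_part n i A)"
proof -
  define e where "e = 2 * n - Suc i"
  have e: "2 * n - i = Suc e"
    using assms(1) by (simp add: e_def)
  have elem: "concat (map (\<lambda>c. [(c - Suc e, column n e), (c - e, column n e)])
      (filter (\<lambda>c. c \<in> A) [Suc (Suc e)..<2 * n])) =
    concat (map (\<lambda>c. map up_back [(c - Suc (Suc e), column n (Suc e)), (c - Suc e, column n (Suc e))])
      (filter (\<lambda>c. c \<in> A) [Suc (Suc e)..<2 * n]))"
    by (intro arg_cong[where f = concat] map_cong refl) (auto simp: up_back_def column_Suc)
  show ?thesis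
  proof (cases "i = 0")
    case True
    then have "2 * n - i \<notin> A"
      using assms(2) by auto
    then show ?thesis
      using True e by (simp add: right_part_def optional_def flip: e_def)
  next
    case False
    then have "[Suc e..<2 * n] = Suc e # [Suc (Suc e)..<2 * n]"
      using assms(1) by (intro upt_conv_Cons) (simp add: e_def)
    then show ?thesis
      unfolding right_part_def e e_def[symmetric] using elem
      by (simp add: optional_def up_back_def column_Suc map_concat comp_def)
  qed
qed

lemma state_points_Suc:
  assumes "i < n" and "A \<subseteq> {1..<2 * n}"
  shows "state_points n (Suc i) A = (map up (left_part n i A @ optional n i A) @
    (if i \<in> A then [(0, column n (Suc i))] else [])) @ singles (column n) i (2 * n - Suc i) A @
    (if 2 * n - i \<in> A then [(0, column n (2 * n - Suc i))] else []) @
    map up_back (optional n (2 * n - i) A @ right_part n i A)"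
proof -
  have "0 \<notin> A"
    using assms(2) by auto
  show ?thesis
    unfolding state_points_def left_part_Suc[OF \<open>0 \<notin> A\<close>] right_part_Suc[OF assms] singles_def
    by (simp del: upt_Suc)
qed

lemma left_part_cong:
  assumes "A \<inter> {1..<i} = B \<inter> {1..<i}"
  shows "left_part n i A = left_part n i B"
proof -
  have "filter (\<lambda>c. c \<in> A) [1..<i] = filter (\<lambda>c. c \<in> B) [1..<i]"
    using assms by (intro filter_cong refl) (auto simp: set_eq_iff)
  then show ?thesis
    by (simp only: left_part_def)
qed

lemma right_part_cong:
  assumes "A \<inter> {Suc (2 * n - i)..<2 * n} = B \<inter> {Suc (2 * n - i)..<2 * n}"
  shows "right_part n i A = right_part n i B"
proof -
  have "filter (\<lambda>c. c \<in> A) [Suc (2 * n - i)..<2 * n] =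
      filter (\<lambda>c. c \<in> B) [Suc (2 * n - i)..<2 * n]"
    using assms by (intro filter_cong refl) (auto simp: set_eq_iff)
  then show ?thesis
    by (simp only: right_part_def)
qed

text \<open>Makes the sign of an expansion depend only on whether column i is a 1-column.\<close>

lemma even_length_left_part: "even (length (left_part n i A))"
  by (simp add: left_part_def length_concat comp_def sum_list_triv)

text \<open>The length hypothesis says that completed 1-columns, counted twice, and active ones,
  counted once, add up to the number of rows. The sign records one odd expansion for each completed
  left 1-column.\<close>

lemma num_states_eq_H:
  assumes "i \<le> n" and "C \<subseteq> {1..<2 * n}" and "length (state_points n i C) = i"
  shows "of_nat (num_states n i C) = (- 1) ^ card (C \<inter> {1..<i}) * H (state_points n i C)"
  using assms
proof (induction i arbitrary: C)
  case 0
  \<comment> \<open>Before the first row every column is active, so an empty list means an empty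
    state.\<close>
  have "C = {}"
  proof (rule ccontr)
    assume "C \<noteq> {}"
    then obtain c where "c \<in> C" "c < 2 * n"
      using "0.prems"(2) by fastforce
    then have "c \<in> set (filter (\<lambda>c. c \<in> C) [0..<Suc (2 * n)])"
      by simp
    moreover have "filter (\<lambda>c. c \<in> C) [0..<Suc (2 * n)] = []"
      using "0.prems"(3) by (simp add: state_points_def del: upt_Suc)
    ultimately show False
      by (metis list.set(1) empty_iff)
  qed
  moreover have "state_points n 0 C = []"
    using "0.prems"(3) by blast
  moreover have "H [] = 1"
    by (simp add: H_def newton_det_def index_pairs_def)
  ultimately show ?case
    by simp
next
  case (Suc i)
  define e where "e = 2 * n - Suc i"
  define L where "L = left_part n i C @ optional n i C"
  define ys where "ys = optional n (2 * n - i) C @ right_part n i C"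
  define s t :: int where "s = of_bool (i \<in> C)" and "t = 1 - of_bool (2 * n - i \<in> C)"
  define P where "P = map up L @ (if s = 1 then [(0, column n (Suc i))] else [])"
  have i: "i < n" "i \<le> e" and e: "2 * n - i = Suc e"
    using Suc.prems(1) by (auto simp: e_def)
  have points: "state_points n (Suc i) C = P @ singles (column n) i e C @
      (if t = 0 then [(0, column n e)] else []) @ map up_back ys"
    using state_points_Suc[OF i(1) Suc.prems(2)] by (simp add: P_def L_def ys_def s_def t_def e_def)
  have IH: "of_nat (num_states n i ((C - {i<..e}) \<union> B)) =
      (- 1) ^ card (C \<inter> {1..<i}) * H (L @ singles (column n) i e B @ ys)"
    if "B \<in> walks i s C e t" for B
  proof -
    let ?A = "(C - {i<..e}) \<union> B"
    have B: "B \<subseteq> {i<..e}" "walk_state i s C B e = t"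
      using that by (auto simp: walks_def)
    have out: "c \<in> ?A \<longleftrightarrow> c \<in> C" if "c \<notin> {i<..e}" for c
      using B(1) that by auto
    have "left_part n i ?A = left_part n i C"
      by (rule left_part_cong) (use B(1) in auto)
    moreover have "right_part n i ?A = right_part n i C"
      unfolding e by (rule right_part_cong) (use B(1) e in auto)
    moreover have "optional n i ?A = optional n i C" "optional n (2 * n - i) ?A = optional n (2 * n - i) C"
      unfolding e optional_def using out[of i] out[of "Suc e"] by simp_all
    moreover have "singles (column n) i e ?A = singles (column n) i e B"
      by (rule singles_cong) auto
    ultimately have A: "state_points n i ?A = L @ singles (column n) i e B @ ys"
      using state_points_split[OF i(1), of ?A] by (simp add: L_def ys_def e_def)
    \<comment> \<open>The row adds s entries at its start and 1 - t at its end, while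
      \<open>C\<close> exceeds \<open>B\<close> by t - s; the total gain is 1.\<close>
    have "length (state_points n i ?A) = i"
    proof -
      have "int (length P) = int (length L) + s"
        by (simp add: P_def s_def)
      moreover have "int (length (if t = 0 then [(0 :: nat, column n e)] else [])) = 1 - t"
        by (simp add: t_def)
      moreover have "t = s + int (length (singles (column n) i e C)) - int (length (singles (column n) i e B))"
        using length_singles[OF i(2), of s C B "column n"] B(2) by simp
      moreover have "int (length (state_points n (Suc i) C)) = int (Suc i)"
        using Suc.prems(3) by simp
      ultimately show ?thesis
        unfolding A points length_append length_map of_nat_add of_nat_Suc by linarith
    qed
    moreover have "?A \<subseteq> {1..<2 * n}"
      using B(1) Suc.prems(2) i by (fastforce simp: e_def)
    moreover have "?A \<inter> {1..<i} = C \<inter> {1..<i}"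
      using B(1) by auto
    ultimately show ?thesis
      using Suc.IH[of ?A] i(1) A by simp
  qed
  have "s \<in> {0, 1}"
    by (simp add: s_def)
  note scan = sum_walks_H[where x = "column n" and s = s and L = L and C = C and ys = ys,
      OF i(2) column_Suc this, folded P_def]
  have "(\<Sum>B\<in>walks i s C e t. H (L @ singles (column n) i e B @ ys)) =
      (- 1) ^ length L * H (state_points n (Suc i) C)"
  proof (cases "t = 0")
    case True
    then show ?thesis
      using scan(2) by (simp add: points)
  next
    case False
    then have t: "t = 1"
      by (simp add: t_def split: if_splits)
    \<comment> \<open>The exceptional empty list cannot occur, since the state has i + 1
      entries.\<close>
    have "P @ singles (column n) i e C @ ys \<noteq> []"
      using Suc.prems(3) False unfolding points by auto
    then show ?thesis
      using scan(1) t by (simp add: points)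
  qed
  moreover have "(- 1 :: rat) ^ card (C \<inter> {1..<Suc i}) = (- 1) ^ card (C \<inter> {1..<i}) * (- 1) ^ length L"
  proof -
    have "(- 1 :: rat) ^ length L = (if i \<in> C then - 1 else 1)"
      using even_length_left_part[of n i C] by (simp add: L_def optional_def)
    moreover have "C \<inter> {1..<Suc i} = (if i \<in> C then insert i (C \<inter> {1..<i}) else C \<inter> {1..<i})"
      using Suc.prems(2) by (auto simp: less_Suc_eq)
    ultimately show ?thesis
      by simp
  qed
  ultimately show ?case
    using IH by (simp add: s_def[symmetric] t_def[symmetric] e_def[symmetric] flip: sum_distrib_left)
qed

section \<open>Triangles as chains of states\<close>

text \<open>Alternation is encoded by partial sums confined to {0, 1}; in this form it splits along
  the pieces of a boundary path.\<close>

fun walk :: "int \<Rightarrow> int list \<Rightarrow> int \<Rightarrow> bool" where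
  "walk s [] t \<longleftrightarrow> s = t \<and> s \<in> {0, 1}"
| "walk s (x # xs) t \<longleftrightarrow> s \<in> {0, 1} \<and> walk (s + x) xs t"

lemma walk_start: "walk s xs t \<Longrightarrow> s \<in> {0, 1}"
  by (cases xs) auto

lemma walk_append: "walk s (xs @ ys) t \<longleftrightarrow> (\<exists>u. walk s xs u \<and> walk u ys t)"
  by (induction xs arbitrary: s) (auto dest: walk_start)

text \<open>Running backwards negates the steps, and the reflection of u to 1 - u restores their
  signs. Needed for the last piece of a boundary path, which climbs its column.\<close>

lemma walk_rev: "walk s (rev xs) t \<longleftrightarrow> walk (1 - t) xs (1 - s)"
proof (induction xs arbitrary: s t)
  case (Cons x xs)
  have "walk s (rev (x # xs)) t \<longleftrightarrow> (\<exists>u. walk (1 - u) xs (1 - s) \<and> u \<in> {0, 1} \<and> u + x = t \<and> t \<in> {0, 1})"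
    by (auto simp: walk_append Cons.IH)
  also have "\<dots> \<longleftrightarrow> walk (1 - t + x) xs (1 - s) \<and> t \<in> {0, 1}"
  proof -
    have eq: "u + x = t \<longleftrightarrow> u = t - x" for u
      by auto
    have "t - x \<in> {0, 1}" if "walk (1 - (t - x)) xs (1 - s)"
      using walk_start[OF that] by auto
    moreover have "1 - (t - x) = 1 - t + x"
      by simp
    ultimately show ?thesis
      unfolding eq by auto
  qed
  also have "\<dots> \<longleftrightarrow> walk (1 - t) (x # xs) (1 - s)"
    by auto
  finally show ?case .
qed auto

lemma walk_map_upt:
  "walk s (map f [m..<m + k]) t \<longleftrightarrow>
    (\<forall>l\<le>k. s + (\<Sum>i\<in>{m..<m + l}. f i) \<in> {0, 1}) \<and> s + (\<Sum>i\<in>{m..<m + k}. f i) = t"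
proof (induction k arbitrary: t)
  case (Suc k)
  have "walk s (map f [m..<m + Suc k]) t \<longleftrightarrow>
      (\<exists>u. walk s (map f [m..<m + k]) u \<and> u \<in> {0, 1} \<and> u + f (m + k) = t \<and> t \<in> {0, 1})"
    by (auto simp: walk_append)
  also have "\<dots> \<longleftrightarrow> (\<forall>l\<le>k. s + (\<Sum>i\<in>{m..<m + l}. f i) \<in> {0, 1}) \<and>
      s + (\<Sum>i\<in>{m..<m + k}. f i) + f (m + k) = t \<and> t \<in> {0, 1}"
    unfolding Suc.IH by auto
  also have "\<dots> \<longleftrightarrow> (\<forall>l\<le>Suc k. s + (\<Sum>i\<in>{m..<m + l}. f i) \<in> {0, 1}) \<and>
      s + (\<Sum>i\<in>{m..<m + Suc k}. f i) = t"
    by (auto simp: le_Suc_eq add.assoc)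
  finally show ?case .
qed auto

lemma walk_end: "walk s xs t \<Longrightarrow> t = s + sum_list xs \<and> t \<in> {0, 1}"
proof (induction xs arbitrary: s)
  case (Cons x xs)
  then have "walk (s + x) xs t"
    by simp
  then show ?case
    using Cons.IH by fastforce
qed auto

text \<open>From \<open>s\<close> the only non-zero step that stays in {0, 1} is
  \<open>1 - 2 * s\<close>, and it leads to 1 - s, where the required sign is reversed.\<close>

lemma alternating_iff_walk:
  assumes "\<And>x. x \<in> set xs \<Longrightarrow> x \<in> {0, 1, - 1}" and "s \<in> {0, 1}"
  shows "alternating xs \<and> (\<forall>u us. filter (\<lambda>u. u \<noteq> 0) xs = u # us \<longrightarrow> u = 1 - 2 * s) \<longleftrightarrow>
    walk s xs (s + sum_list xs)"
  using assms
proof (induction xs arbitrary: s)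
  case Nil
  then show ?case
    by (auto simp: alternating_def)
next
  case (Cons x xs)
  show ?case
  proof (cases "x = 0")
    case True
    then show ?thesis
      using Cons.IH[of s] Cons.prems by (simp add: alternating_def)
  next
    case False
    then have x: "x = 1 \<or> x = - 1"
      using Cons.prems(1)[of x] by auto
    show ?thesis
    proof (cases "x = 1 - 2 * s")
      case True
      then have "s + x \<in> {0, 1}" and s': "1 - 2 * (s + x) = - x"
        using Cons.prems(2) by auto
      then have IH: "alternating xs \<and> (\<forall>u us. filter (\<lambda>u. u \<noteq> 0) xs = u # us \<longrightarrow> u = - x) \<longleftrightarrow>
          walk (s + x) xs (s + x + sum_list xs)"
        using Cons.IH[of "s + x"] Cons.prems(1) unfolding s' by simp
      have "alternating (x # xs) \<longleftrightarrow>
          alternating xs \<and> (\<forall>u us. filter (\<lambda>u. u \<noteq> 0) xs = u # us \<longrightarrow> u = - x)"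
        using False by (cases "filter (\<lambda>u. u \<noteq> 0) xs") (auto simp: alternating_def)
      moreover have "walk s (x # xs) (s + sum_list (x # xs)) \<longleftrightarrow>
          walk (s + x) xs (s + x + sum_list xs)"
        using Cons.prems(2) by (simp add: add.assoc)
      moreover have "(\<forall>u us. filter (\<lambda>u. u \<noteq> 0) (x # xs) = u # us \<longrightarrow> u = 1 - 2 * s)"
        using False True by simp
      ultimately show ?thesis
        using IH by argo
    next
      case nx: False
      then have "s + x \<notin> {0, 1}"
        using x Cons.prems(2) by auto
      then have "\<not> walk (s + x) xs t" for t
        using walk_start by blast
      then show ?thesis
        using nx False by simp
    qed
  qed
qed

lemma alternating_sum_1_iff:
  assumes "\<And>x. x \<in> set xs \<Longrightarrow> x \<in> {0, 1, - 1}"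
  shows "alternating xs \<and> sum_list xs = 1 \<longleftrightarrow> walk 0 xs 1"
proof (intro iffI conjI; (elim conjE)?)
  assume alt: "alternating xs" and sum: "sum_list xs = 1"
  have "u = 1" if u: "filter (\<lambda>u. u \<noteq> 0) xs = u # us" for u us
  proof (rule ccontr)
    assume "u \<noteq> 1"
    have "u \<in> set (filter (\<lambda>u. u \<noteq> 0) xs)"
      unfolding u by simp
    then have "u \<in> set xs" "u \<noteq> 0"
      by simp_all
    then have "u = - 1"
      using assms[of u] \<open>u \<noteq> 1\<close> by simp
    \<comment> \<open>If the first non-zero entry were -1, a walk from 1 would end at 1 + 1 =
      2.\<close>
    then have "walk 1 xs (1 + sum_list xs)"
      using alternating_iff_walk[OF assms, of xs 1] alt u by simp
    then show False
      using walk_end[of 1 xs "1 + sum_list xs"] sum by simp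
  qed
  then show "walk 0 xs 1"
    using alternating_iff_walk[OF assms, of xs 0] alt sum by simp
next
  assume w: "walk 0 xs 1"
  then show "sum_list xs = 1"
    using walk_end by fastforce
  then show "alternating xs"
    using alternating_iff_walk[OF assms, of xs 0] w by simp
qed

section \<open>Column partial sums and states\<close>

definition partial_sum :: "(nat \<Rightarrow> nat \<Rightarrow> int) \<Rightarrow> nat \<Rightarrow> nat \<Rightarrow> int" where
  "partial_sum a r c = (\<Sum>i\<in>{1..r}. a i c)"

lemma partial_sum_Suc: "partial_sum a (Suc r) c = partial_sum a r c + a (Suc r) c"
  by (simp add: partial_sum_def)

definition state :: "(nat \<Rightarrow> nat \<Rightarrow> int) \<Rightarrow> nat \<Rightarrow> nat set" where
  "state a r = {c. partial_sum a r c = 1}"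

definition row_step :: "nat \<Rightarrow> nat \<Rightarrow> nat set \<Rightarrow> nat set \<Rightarrow> bool" where
  "row_step n r A C \<longleftrightarrow> A - {r<..2 * n - Suc r} = C - {r<..2 * n - Suc r} \<and>
     A \<inter> {r<..2 * n - Suc r} \<in>
       walks r (of_bool (r \<in> C)) C (2 * n - Suc r) (1 - of_bool (2 * n - r \<in> C))"

text \<open>Triangles cut off after row i: later rows are zero, so a new row is added by a function
  update.\<close>

definition arrays :: "nat \<Rightarrow> nat \<Rightarrow> nat set \<Rightarrow> (nat \<Rightarrow> nat \<Rightarrow> int) set" where
  "arrays n i C = {a. (\<forall>r. r \<notin> {1..i} \<longrightarrow> a r = (\<lambda>_. 0)) \<and>
     (\<forall>r\<le>i. \<forall>c. partial_sum a r c \<in> {0, 1}) \<and>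
     (\<forall>r<i. row_step n r (state a r) (state a (Suc r))) \<and> state a i = C}"

lemma partial_sum_upd: "r \<le> i \<Longrightarrow> partial_sum (a(Suc i := f)) r c = partial_sum a r c"
  unfolding partial_sum_def by (rule sum.cong) auto

lemma state_upd: "r \<le> i \<Longrightarrow> state (a(Suc i := f)) r = state a r"
  by (simp add: state_def partial_sum_upd)

definition row_entries :: "nat set \<Rightarrow> nat set \<Rightarrow> nat \<Rightarrow> int" where
  "row_entries A C c = of_bool (c \<in> C) - of_bool (c \<in> A)"

lemma of_bool_state:
  "partial_sum a r c \<in> {0, 1} \<Longrightarrow> of_bool (c \<in> state a r) = partial_sum a r c"
  by (auto simp: state_def)

lemma arrays_Suc_upd:
  assumes a: "a \<in> arrays n i A" and step: "row_step n i A C"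
  shows "a(Suc i := row_entries A C) \<in> arrays n (Suc i) C"
proof -
  let ?b = "a(Suc i := row_entries A C)"
  have A: "state a i = A" and "\<And>c. partial_sum a i c \<in> {0, 1}"
    using a by (auto simp: arrays_def)
  then have ps: "partial_sum a i c = of_bool (c \<in> A)" for c
    using of_bool_state by metis
  have last: "partial_sum ?b (Suc i) c = of_bool (c \<in> C)" for c
    by (simp add: partial_sum_Suc partial_sum_upd ps row_entries_def)
  then have C: "state ?b (Suc i) = C"
    by (simp add: state_def)
  have "\<forall>r\<le>Suc i. \<forall>c. partial_sum ?b r c \<in> {0, 1}"
    using a last by (auto simp: arrays_def le_Suc_eq partial_sum_upd)
  moreover have "row_step n r (state ?b r) (state ?b (Suc r))" if "r < Suc i" for r
    using that a step A C by (cases "r = i") (auto simp: arrays_def state_upd)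
  ultimately show ?thesis
    using a C by (auto simp: arrays_def)
qed

lemma arrays_Suc_cases:
  assumes a: "a \<in> arrays n (Suc i) C"
  shows "a(Suc i := \<lambda>_. 0) \<in> arrays n i (state a i)" and "row_step n i (state a i) C"
    and "a (Suc i) = row_entries (state a i) C"
proof -
  have C: "state a (Suc i) = C" and ps: "\<And>r c. r \<le> Suc i \<Longrightarrow> partial_sum a r c \<in> {0, 1}"
    using a by (auto simp: arrays_def)
  show "row_step n i (state a i) C"
    using a by (auto simp: arrays_def)
  show "a(Suc i := \<lambda>_. 0) \<in> arrays n i (state a i)"
    using a by (auto simp: arrays_def partial_sum_upd state_upd)
  have "a (Suc i) c = row_entries (state a i) C c" for c
    using ps[of i c] ps[of "Suc i" c] of_bool_state[of a i c] of_bool_state[of a "Suc i" c]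
    by (simp add: row_entries_def C partial_sum_Suc)
  then show "a (Suc i) = row_entries (state a i) C"
    by blast
qed

text \<open>The states before and after the last row determine it. The arrays therefore fall into
  disjoint classes according to the previous state, each a copy of a set of shorter arrays.\<close>

lemma card_arrays: "finite (arrays n i C) \<and> card (arrays n i C) = num_states n i C"
proof (induction i arbitrary: C)
  case 0
  have "arrays n 0 C = (if C = {} then {\<lambda>_ _. 0} else {})"
    by (auto simp: arrays_def state_def partial_sum_def fun_eq_iff)
  then show ?case
    by simp
next
  case (Suc i)
  define e where "e = 2 * n - Suc i"
  define W where "W = walks i (of_bool (i \<in> C)) C e (1 - of_bool (2 * n - i \<in> C))"
  define A where "A B = (C - {i<..e}) \<union> B" for B
  define X where "X B = (\<lambda>a. a(Suc i := row_entries (A B) C)) ` arrays n i (A B)" for B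
  have sub: "B \<subseteq> {i<..e}" if "B \<in> W" for B
    using that by (auto simp: W_def walks_def)
  have step: "row_step n i (A B) C" if "B \<in> W" for B
  proof -
    have "A B \<inter> {i<..e} = B" "A B - {i<..e} = C - {i<..e}"
      using sub[OF that] by (auto simp: A_def)
    then show ?thesis
      using that by (simp add: row_step_def W_def e_def)
  qed
  have X: "arrays n (Suc i) C = (\<Union>B\<in>W. X B)"
  proof (intro equalityI subsetI)
    fix a assume a: "a \<in> arrays n (Suc i) C"
    define B where "B = state a i \<inter> {i<..e}"
    have B: "B \<in> W" "state a i = A B"
      using arrays_Suc_cases(2)[OF a] by (auto simp: row_step_def W_def B_def A_def e_def)
    have "a \<in> X B"
      unfolding X_def
    proof (rule image_eqI)
      show "a = (a(Suc i := \<lambda>_. 0))(Suc i := row_entries (A B) C)"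
        using arrays_Suc_cases(3)[OF a] B(2) by auto
      show "a(Suc i := \<lambda>_. 0) \<in> arrays n i (A B)"
        using arrays_Suc_cases(1)[OF a] B(2) by simp
    qed
    then show "a \<in> (\<Union>B\<in>W. X B)"
      using B(1) by blast
  next
    fix a assume "a \<in> (\<Union>B\<in>W. X B)"
    then show "a \<in> arrays n (Suc i) C"
      using step by (auto simp: X_def intro: arrays_Suc_upd)
  qed
  have inj: "inj_on (\<lambda>a. a(Suc i := row_entries (A B) C)) (arrays n i (A B))" for B
  proof (rule inj_onI)
    fix a b assume ab: "a \<in> arrays n i (A B)" "b \<in> arrays n i (A B)"
      and eq: "a(Suc i := row_entries (A B) C) = b(Suc i := row_entries (A B) C)"
    have "a (Suc i) = b (Suc i)"
      using ab by (simp add: arrays_def)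
    then show "a = b"
      using eq by (metis fun_upd_triv fun_upd_upd)
  qed
  have fin: "finite (X B)" and card: "card (X B) = num_states n i (A B)" for B
    using Suc.IH inj by (auto simp: X_def card_image)
  have "X B \<inter> X B' = {}" if "B \<in> W" "B' \<in> W" "B \<noteq> B'" for B B'
  proof -
    have "state a i = A B" if "a \<in> X B" for a B
      using that by (auto simp: X_def state_upd arrays_def)
    moreover have "A B \<noteq> A B'"
      using that sub unfolding A_def by blast
    ultimately show ?thesis
      by (metis disjoint_iff)
  qed
  then have "card (arrays n (Suc i) C) = (\<Sum>B\<in>W. card (X B))"
    unfolding X using fin by (intro card_UN_disjoint) (auto simp: W_def finite_walks)
  moreover have "finite (arrays n (Suc i) C)"
    unfolding X using fin by (auto simp: W_def finite_walks)
  ultimately show ?case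
    by (simp add: card W_def A_def e_def)
qed

section \<open>The boundary condition in terms of partial sums\<close>

definition row_condition :: "nat \<Rightarrow> (nat \<Rightarrow> nat \<Rightarrow> int) \<Rightarrow> nat \<Rightarrow> bool" where
  "row_condition n a r \<longleftrightarrow>
     (\<forall>c\<in>{r..2 * n - Suc r}. partial_sum a r r + (\<Sum>l\<in>{r<..c}. a (Suc r) l) \<in> {0, 1}) \<and>
     partial_sum a r r + (\<Sum>l\<in>{r<..2 * n - Suc r}. a (Suc r) l) = 1 - partial_sum a r (2 * n - r)"

lemma walk_column:
  "walk 0 (map (\<lambda>i. a i c) [1..<j + 1]) u \<longleftrightarrow>
    (\<forall>r\<le>j. partial_sum a r c \<in> {0, 1}) \<and> partial_sum a j c = u"
  using walk_map_upt[of 0 "\<lambda>i. a i c" 1 j u]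
  by (simp add: partial_sum_def atLeastLessThanSuc_atLeastAtMost del: upt_Suc)

lemma walk_row:
  assumes "j < n"
  shows "walk s (map (a (j + 1)) [j + 1..<2 * n - j]) t \<longleftrightarrow>
    (\<forall>c\<in>{j..2 * n - Suc j}. s + (\<Sum>l\<in>{j<..c}. a (Suc j) l) \<in> {0, 1}) \<and>
    s + (\<Sum>l\<in>{j<..2 * n - Suc j}. a (Suc j) l) = t"
proof -
  define k where "k = 2 * n - Suc j - j"
  have k: "2 * n - Suc j = j + k" "2 * n - j = Suc j + k"
    using assms by (auto simp: k_def)
  have *: "{Suc j..<Suc j + l} = {j<..j + l}" for l
    by auto
  have "walk s (map (a (Suc j)) [Suc j..<Suc j + k]) t \<longleftrightarrow>
      (\<forall>l\<le>k. s + (\<Sum>i\<in>{j<..j + l}. a (Suc j) i) \<in> {0, 1}) \<and> s + (\<Sum>i\<in>{j<..j + k}. a (Suc j) i) = t"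
    unfolding walk_map_upt * ..
  also have "(\<forall>l\<le>k. s + (\<Sum>i\<in>{j<..j + l}. a (Suc j) i) \<in> {0, 1}) \<longleftrightarrow>
      (\<forall>c\<in>{j..j + k}. s + (\<Sum>i\<in>{j<..c}. a (Suc j) i) \<in> {0, 1})"
  proof
    assume all: "\<forall>l\<le>k. s + (\<Sum>i\<in>{j<..j + l}. a (Suc j) i) \<in> {0, 1}"
    show "\<forall>c\<in>{j..j + k}. s + (\<Sum>i\<in>{j<..c}. a (Suc j) i) \<in> {0, 1}"
    proof
      fix c assume "c \<in> {j..j + k}"
      then show "s + (\<Sum>i\<in>{j<..c}. a (Suc j) i) \<in> {0, 1}"
        using all[rule_format, of "c - j"] by auto
    qed
  qed auto
  finally show ?thesis
    unfolding k by simp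
qed

text \<open>The path descends a column, crosses a row and climbs the mirror column. Since it must
  end at 1, the climb prescribes the counter at the end of the row.\<close>

lemma walk_boundary_path:
  assumes "j < n"
  shows "walk 0 (boundary_path n a j) 1 \<longleftrightarrow>
    (\<forall>r\<le>j. partial_sum a r j \<in> {0, 1}) \<and> (\<forall>r\<le>j. partial_sum a r (2 * n - j) \<in> {0, 1}) \<and>
    row_condition n a j"
proof -
  have "walk v (map (\<lambda>i. a i (2 * n - j)) (rev [1..<j + 1])) 1 \<longleftrightarrow>
      (\<forall>r\<le>j. partial_sum a r (2 * n - j) \<in> {0, 1}) \<and> v = 1 - partial_sum a j (2 * n - j)" for v
    by (simp only: rev_map[symmetric] walk_rev diff_self walk_column) auto
  then show ?thesis
    unfolding boundary_path_def walk_append walk_column walk_row[OF assms] row_condition_def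
    by auto
qed

lemma walk_central_column:
  "(\<exists>t. walk 0 (central_column n a) t) \<longleftrightarrow> (\<forall>r\<le>n. partial_sum a r n \<in> {0, 1})"
  unfolding central_column_def walk_column by simp

lemma partial_sum_extend:
  assumes "k \<le> r" and "\<And>i. k < i \<Longrightarrow> a i c = 0"
  shows "partial_sum a r c = partial_sum a k c"
  using assms(1) by (induction rule: dec_induct) (simp_all add: partial_sum_Suc assms(2))

text \<open>Below its last entry a column has constant partial sum, so bounds down to that entry
  suffice. The boundary paths provide them for all columns but the central one.\<close>

lemma partial_sums_bool_iff:
  assumes zero: "\<forall>i j. (i, j) \<notin> positions n \<longrightarrow> a i j = 0"
  shows "(\<forall>r\<le>n. \<forall>c. partial_sum a r c \<in> {0, 1}) \<longleftrightarrow>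
    (\<forall>j<n. (\<forall>r\<le>j. partial_sum a r j \<in> {0, 1}) \<and> (\<forall>r\<le>j. partial_sum a r (2 * n - j) \<in> {0, 1})) \<and>
    (\<forall>r\<le>n. partial_sum a r n \<in> {0, 1})" (is "?L \<longleftrightarrow> ?R")
proof
  assume R: ?R
  show ?L
  proof (intro allI impI)
    fix r c assume "r \<le> n"
    consider "c < n" | "c = n" | "n < c" "c \<le> 2 * n" | "2 * n < c"
      by linarith
    then show "partial_sum a r c \<in> {0, 1}"
    proof cases
      case 1
      have "partial_sum a r c = partial_sum a (min r c) c"
      proof (cases "r \<le> c")
        case False
        then show ?thesis
          using partial_sum_extend[of c r a c] zero by (simp add: positions_def)
      qed simp
      then show ?thesis
        using R 1 by (metis min.cobounded2)
    next
      case 2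
      then show ?thesis
        using R \<open>r \<le> n\<close> by simp
    next
      case 3
      then have c: "2 * n - (2 * n - c) = c" "2 * n - c < n"
        by auto
      have "partial_sum a r c = partial_sum a (min r (2 * n - c)) c"
      proof (cases "r \<le> 2 * n - c")
        case False
        moreover have "a i c = 0" if "2 * n - c < i" for i
          using that 3 by (intro zero[rule_format]) (auto simp: positions_def)
        ultimately show ?thesis
          using partial_sum_extend[of "2 * n - c" r a c] by simp
      qed simp
      then show ?thesis
        using R c by (metis min.cobounded2)
    next
      case 4
      then have "partial_sum a r c = 0"
        unfolding partial_sum_def by (intro sum.neutral ballI zero[rule_format]) (auto simp: positions_def)
      then show ?thesis
        by simp
    qed
  qed
qed auto

lemma entry_bool:
  assumes "partial_sum a r c \<in> {0, 1}" and "partial_sum a (Suc r) c \<in> {0, 1}"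
  shows "a (Suc r) c \<in> {0, 1, - 1}"
  using assms by (auto simp: partial_sum_Suc)

text \<open>The restriction on the entries is absorbed: they are differences of successive partial
  sums in {0, 1}.\<close>

lemma odd_oosasm_triangle_iff:
  "odd_oosasm_triangle n a \<longleftrightarrow> (\<forall>i j. (i, j) \<notin> positions n \<longrightarrow> a i j = 0) \<and>
    (\<forall>r\<le>n. \<forall>c. partial_sum a r c \<in> {0, 1}) \<and> (\<forall>j<n. row_condition n a j)"
proof (cases "(\<forall>i j. (i, j) \<notin> positions n \<longrightarrow> a i j = 0) \<and> (\<forall>i j. a i j \<in> {0, 1, - 1})")
  case True
  have path: "x \<in> {0, 1, - 1}" if "x \<in> set (boundary_path n a j)" for x j
  proof -
    obtain i l where "x = a i l"
      using \<open>x \<in> set (boundary_path n a j)\<close> by (auto simp: boundary_path_def simp del: upt_Suc)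
    then show ?thesis
      using True by blast
  qed
  have central: "x \<in> {0, 1, - 1}" if "x \<in> set (central_column n a)" for x
  proof -
    obtain i where "x = a i n"
      using \<open>x \<in> set (central_column n a)\<close> by (auto simp: central_column_def simp del: upt_Suc)
    then show ?thesis
      using True by blast
  qed
  have "alternating (central_column n a) \<and>
      (\<forall>u us. filter (\<lambda>u. u \<noteq> 0) (central_column n a) = u # us \<longrightarrow> u = 1) \<longleftrightarrow>
    (\<exists>t. walk 0 (central_column n a) t)"
    using alternating_iff_walk[OF central, where s = 0] walk_end[of 0 "central_column n a"] by auto
  note central_iff = this
  have path_iff: "alternating (boundary_path n a j) \<and> sum_list (boundary_path n a j) = 1 \<longleftrightarrow>
      walk 0 (boundary_path n a j) 1" for j
    by (rule alternating_sum_1_iff) (rule path)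
  have zero: "\<forall>i j. (i, j) \<notin> positions n \<longrightarrow> a i j = 0"
    using True by blast
  have "odd_oosasm_triangle n a \<longleftrightarrow>
      (\<forall>j<n. alternating (boundary_path n a j) \<and> sum_list (boundary_path n a j) = 1) \<and>
      (alternating (central_column n a) \<and>
        (\<forall>u us. filter (\<lambda>u. u \<noteq> 0) (central_column n a) = u # us \<longrightarrow> u = 1))"
    using True unfolding odd_oosasm_triangle_def by blast
  also have "\<dots> \<longleftrightarrow> (\<forall>j<n. walk 0 (boundary_path n a j) 1) \<and> (\<forall>r\<le>n. partial_sum a r n \<in> {0, 1})"
    by (simp only: central_iff walk_central_column path_iff)
  also have "\<dots> \<longleftrightarrow> (\<forall>r\<le>n. \<forall>c. partial_sum a r c \<in> {0, 1}) \<and> (\<forall>j<n. row_condition n a j)"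
  proof -
    have "(\<forall>j<n. walk 0 (boundary_path n a j) 1) \<longleftrightarrow> (\<forall>j<n. (\<forall>r\<le>j. partial_sum a r j \<in> {0, 1}) \<and>
        (\<forall>r\<le>j. partial_sum a r (2 * n - j) \<in> {0, 1})) \<and> (\<forall>j<n. row_condition n a j)"
      using walk_boundary_path[of _ n a] by (metis (no_types, lifting))
    then show ?thesis
      by (simp only: partial_sums_bool_iff[OF zero] conj_ac)
  qed
  finally show ?thesis
    using True by blast
next
  case False
  have "a i j \<in> {0, 1, - 1}" if z: "\<forall>i j. (i, j) \<notin> positions n \<longrightarrow> a i j = 0"
    and ps: "\<forall>r\<le>n. \<forall>c. partial_sum a r c \<in> {0, 1}" for i j
  proof (cases "(i, j) \<in> positions n")
    case True
    then obtain r where "i = Suc r" "Suc r \<le> n"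
      by (cases i) (auto simp: positions_def)
    then show ?thesis
      using entry_bool[of a r j] ps by simp
  qed (use z in simp)
  then show ?thesis
    using False unfolding odd_oosasm_triangle_def by blast
qed

lemma row_step_iff:
  assumes "r < n" and ps: "\<And>c. partial_sum a r c \<in> {0, 1}" "\<And>c. partial_sum a (Suc r) c \<in> {0, 1}"
  shows "row_step n r (state a r) (state a (Suc r)) \<longleftrightarrow>
    (\<forall>c. c \<notin> {r<..2 * n - Suc r} \<longrightarrow> a (Suc r) c = 0) \<and> row_condition n a r"
proof -
  define e where "e = 2 * n - Suc r"
  let ?A = "state a r" and ?C = "state a (Suc r)"
  have entry: "a (Suc r) c = of_bool (c \<in> ?C) - of_bool (c \<in> ?A)" for c
    using of_bool_state[OF ps(1), of c] of_bool_state[OF ps(2), of c] by (simp add: partial_sum_Suc)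
  have "?A - {r<..e} = ?C - {r<..e} \<longleftrightarrow> (\<forall>c. c \<notin> {r<..e} \<longrightarrow> (c \<in> ?A \<longleftrightarrow> c \<in> ?C))"
    by blast
  also have "\<dots> \<longleftrightarrow> (\<forall>c. c \<notin> {r<..e} \<longrightarrow> a (Suc r) c = 0)"
    unfolding entry by (intro iff_allI imp_cong refl) auto
  finally have outside: "?A - {r<..e} = ?C - {r<..e} \<longleftrightarrow> (\<forall>c. c \<notin> {r<..e} \<longrightarrow> a (Suc r) c = 0)" .
  have "?A \<inter> {r<..e} \<in> walks r (of_bool (r \<in> ?C)) ?C e (1 - of_bool (2 * n - r \<in> ?C)) \<longleftrightarrow>
      row_condition n a r" if "\<forall>c. c \<notin> {r<..e} \<longrightarrow> a (Suc r) c = 0"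
  proof -
    have "2 * n - r = Suc e"
      using assms(1) by (simp add: e_def)
    then have "a (Suc r) r = 0" "a (Suc r) (2 * n - r) = 0"
      using that by simp_all
    \<comment> \<open>Row r + 1 does not reach columns r and 2n - r, so the new state still shows
      their partial sums after r rows.\<close>
    then have ends: "of_bool (r \<in> ?C) = partial_sum a r r"
      "of_bool (2 * n - r \<in> ?C) = partial_sum a r (2 * n - r)"
      using of_bool_state[OF ps(2)] by (simp_all add: partial_sum_Suc)
    have "walk_state r (partial_sum a r r) ?C (?A \<inter> {r<..e}) c =
        partial_sum a r r + (\<Sum>l\<in>{r<..c}. a (Suc r) l)" if "c \<le> e" for c
      unfolding walk_state_def entry using that
      by (intro arg_cong2[of _ _ _ _ "(+)"] refl sum.cong) auto
    then show ?thesis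
      unfolding ends by (simp add: walks_def row_condition_def flip: e_def)
  qed
  then show ?thesis
    unfolding row_step_def e_def[symmetric] outside by blast
qed

lemma odd_oosasm_triangle_iff_arrays: "odd_oosasm_triangle n a \<longleftrightarrow> a \<in> arrays n n (state a n)"
proof (cases "\<forall>r\<le>n. \<forall>c. partial_sum a r c \<in> {0, 1}")
  case True
  have "(\<forall>i j. (i, j) \<notin> positions n \<longrightarrow> a i j = 0) \<longleftrightarrow>
      (\<forall>r. r \<notin> {1..n} \<longrightarrow> a r = (\<lambda>_. 0)) \<and>
      (\<forall>r<n. \<forall>c. c \<notin> {r<..2 * n - Suc r} \<longrightarrow> a (Suc r) c = 0)" (is "?L \<longleftrightarrow> ?R")
  proof
    assume ?L
    then show ?R
      by (auto simp: positions_def fun_eq_iff)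
  next
    assume R: ?R
    show ?L
    proof (intro allI impI)
      fix i j assume ij: "(i, j) \<notin> positions n"
      show "a i j = 0"
      proof (cases "i \<in> {1..n}")
        case True
        then obtain r where "i = Suc r" "r < n"
          by (cases i) auto
        then show ?thesis
          using R ij by (auto simp: positions_def)
      qed (use R in simp)
    qed
  qed
  moreover have "row_step n r (state a r) (state a (Suc r)) \<longleftrightarrow>
    (\<forall>c. c \<notin> {r<..2 * n - Suc r} \<longrightarrow> a (Suc r) c = 0) \<and> row_condition n a r" if "r < n" for r
    using row_step_iff[OF that] True that by simp
  ultimately show ?thesis
    using True unfolding odd_oosasm_triangle_iff arrays_def by auto
next
  case False
  then show ?thesis
    unfolding odd_oosasm_triangle_iff arrays_def by blast
qed

lemma num_triangles_eq_num_states: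
  assumes "1 \<le> n" and "S \<subseteq> {- int n + 1..int n - 1}"
  shows "num_triangles n S = num_states n n ((\<lambda>c. nat (int n + c)) ` S)"
proof -
  let ?f = "\<lambda>c. nat (int n + c)" and ?R = "{- int n + 1..int n - 1}"
  have "one_columns n a = S \<longleftrightarrow> state a n = ?f ` S" if "odd_oosasm_triangle n a" for a
  proof -
    have zero: "a i j = 0" if "(i, j) \<notin> positions n" for i j
      using \<open>odd_oosasm_triangle n a\<close> that by (simp add: odd_oosasm_triangle_def)
    have "column_sum n a c = partial_sum a n (?f c)" for c
      unfolding column_sum_def partial_sum_def
      by (rule sum.mono_neutral_left) (auto simp: positions_def intro!: zero)
    then have cols: "one_columns n a = {c \<in> ?R. ?f c \<in> state a n}"
      by (simp add: one_columns_def state_def)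
    \<comment> \<open>A column without positions has sum 0, so every element of the state comes from
      a column number.\<close>
    have "state a n \<subseteq> ?f ` ?R"
    proof
      fix c assume "c \<in> state a n"
      then have "(\<Sum>i\<in>{1..n}. a i c) \<noteq> 0"
        by (simp add: state_def partial_sum_def)
      then obtain i where "i \<in> {1..n}" "a i c \<noteq> 0"
        by (meson sum.neutral)
      then have "(i, c) \<in> positions n" "1 \<le> i"
        using zero by auto
      then have "1 \<le> c" "c \<le> 2 * n - 1"
        by (auto simp: positions_def)
      then have "int c - int n \<in> ?R" "c = ?f (int c - int n)"
        using assms(1) by auto
      then show "c \<in> ?f ` ?R"
        by blast
    qed
    moreover have inj: "inj_on ?f ?R"
      by (rule inj_onI) auto
    ultimately show ?thesis
      unfolding cols
    proof (intro iffI)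
      assume sub: "state a n \<subseteq> ?f ` ?R" and eq: "{c \<in> ?R. ?f c \<in> state a n} = S"
      show "state a n = ?f ` S"
      proof (intro equalityI subsetI)
        fix x assume "x \<in> state a n"
        moreover obtain c where "c \<in> ?R" "x = ?f c"
          using sub calculation by blast
        ultimately have "c \<in> S"
          unfolding eq[symmetric] by simp
        then show "x \<in> ?f ` S"
          using \<open>x = ?f c\<close> by blast
      next
        fix x assume "x \<in> ?f ` S"
        then obtain c where "c \<in> S" "x = ?f c"
          by blast
        then show "x \<in> state a n"
          unfolding eq[symmetric] by simp
      qed
    next
      assume "state a n = ?f ` S"
      then show "{c \<in> ?R. ?f c \<in> state a n} = S"
        using inj_on_image_mem_iff[OF inj _ assms(2)] assms(2) by blast
    qed
  qed
  then have "{a. odd_oosasm_triangle n a \<and> one_columns n a = S} = arrays n n (?f ` S)"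
    unfolding odd_oosasm_triangle_iff_arrays by (auto simp: arrays_def)
  then show ?thesis
    using card_arrays by (simp add: num_triangles_def)
qed

section \<open>The operator formula\<close>

definition start_point :: "(nat \<Rightarrow> bool \<times> nat) \<Rightarrow> nat \<Rightarrow> nat \<times> rat" where
  "start_point w t = (snd (w t), if fst (w t) then - of_nat (snd (w t)) else 0)"

lemma concat_map_odd_even:
  "a \<le> b \<Longrightarrow>
    concat (map (\<lambda>i. [f (2 * i - 1), f (2 * i)]) [a + 1..<b + 1]) = map f [2 * a + 1..<2 * b + 1]"
  by (induction rule: dec_induct) simp_all

lemma concat_map_even_odd:
  "a \<le> b \<Longrightarrow>
    concat (map (\<lambda>i. [f (2 * i), f (2 * i + 1)]) [a + 1..<b + 1]) = map f [2 * a + 2..<2 * b + 2]"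
  by (induction rule: dec_induct) simp_all

lemma filter_mem_upt:
  fixes f :: "nat \<Rightarrow> nat"
  assumes f: "strict_mono_on {a..<b} f" and sub: "f ` {a..<b} \<subseteq> {l..<u}"
    and mem: "C \<inter> {l..<u} = f ` {a..<b}"
  shows "filter (\<lambda>c. c \<in> C) [l..<u] = map f [a..<b]"
proof (rule sorted_distinct_set_unique)
  show "sorted (map f [a..<b])"
    unfolding sorted_wrt_iff_nth_less
  proof (intro allI impI)
    fix i k assume "i < k" "k < length (map f [a..<b])"
    then show "map f [a..<b] ! i \<le> map f [a..<b] ! k"
      using strict_mono_onD[OF f, of "a + i" "a + k"] by (simp add: less_imp_le)
  qed
  show "distinct (map f [a..<b])"
    using f by (auto simp: distinct_map strict_mono_on_imp_inj_on)
  show "set (filter (\<lambda>c. c \<in> C) [l..<u]) = set (map f [a..<b])"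
    using mem by auto
qed (simp_all add: sorted_wrt_filter)

lemma op_prod_append: "op_prod (As @ Bs) f = op_prod As (op_prod Bs f)"
  by (induction As) (simp_all add: op_prod_def)

text \<open>\<open>C\<close> is prescribed only away from the central column \<open>n\<close>, so
  that both parities share the computation.\<close>

locale one_column_data =
  fixes N m n :: nat and j :: "nat \<Rightarrow> int" and C :: "nat set"
  assumes n_pos: "1 \<le> n"
    and m_le: "m \<le> N"
    and mono: "strict_mono_on {1..N} j"
    and neg: "\<And>i. i \<in> {1..m} \<Longrightarrow> j i < 0"
    and pos: "\<And>i. i \<in> {m + 1..N} \<Longrightarrow> 0 < j i"
    and range: "\<And>i. i \<in> {1..N} \<Longrightarrow> - int n + 1 \<le> j i \<and> j i \<le> int n - 1"
    and C: "C - {n} = (\<lambda>i. nat (int n + j i)) ` {1..N}"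
begin

definition col :: "nat \<Rightarrow> nat" where
  "col i = nat (int n + j i)"

lemma int_col: "i \<in> {1..N} \<Longrightarrow> int (col i) = int n + j i"
  using range[of i] by (simp add: col_def)

lemma col_less_iff: "i \<in> {1..N} \<Longrightarrow> col i < n \<longleftrightarrow> i \<le> m" and col_neq: "i \<in> {1..N} \<Longrightarrow> col i \<noteq> n"
  using int_col[of i] neg[of i] pos[of i] by (cases "i \<le> m"; force)+

lemma strict_mono_col: "A \<subseteq> {1..N} \<Longrightarrow> strict_mono_on A col"
proof (rule strict_mono_onI)
  fix r s assume "A \<subseteq> {1..N}" "r \<in> A" "s \<in> A" "r < s"
  then have rs: "r \<in> {1..N}" "s \<in> {1..N}"
    by blast+
  then have "j r < j s"
    using mono \<open>r < s\<close> unfolding strict_mono_on_def by blast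
  then show "col r < col s"
    using int_col[of r] int_col[of s] rs by linarith
qed

lemma filter_left: "filter (\<lambda>c. c \<in> C) [1..<n] = map col [1..<m + 1]"
proof (rule filter_mem_upt)
  show "strict_mono_on {1..<m + 1} col"
    using m_le by (intro strict_mono_col) auto
  show sub: "col ` {1..<m + 1} \<subseteq> {1..<n}"
  proof
    fix c assume "c \<in> col ` {1..<m + 1}"
    then obtain i where i: "c = col i" "i \<in> {1..N}" "i \<le> m"
      using m_le by auto
    then show "c \<in> {1..<n}"
      using int_col[of i] range[of i] col_less_iff[of i] by auto
  qed
  show "C \<inter> {1..<n} = col ` {1..<m + 1}"
  proof (intro equalityI subsetI)
    fix c assume c: "c \<in> C \<inter> {1..<n}"
    then have "c \<in> C - {n}"
      by auto
    then obtain i where "c = col i" "i \<in> {1..N}"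
      unfolding C col_def by auto
    then show "c \<in> col ` {1..<m + 1}"
      using c col_less_iff[of i] by auto
  next
    fix c assume c: "c \<in> col ` {1..<m + 1}"
    then have "c \<in> C - {n}"
      unfolding C col_def using m_le by auto
    then show "c \<in> C \<inter> {1..<n}"
      using c sub by blast
  qed
qed

lemma filter_right: "filter (\<lambda>c. c \<in> C) [Suc n..<2 * n] = map col [m + 1..<N + 1]"
proof (rule filter_mem_upt)
  show "strict_mono_on {m + 1..<N + 1} col"
    by (intro strict_mono_col) auto
  show sub: "col ` {m + 1..<N + 1} \<subseteq> {Suc n..<2 * n}"
  proof
    fix c assume "c \<in> col ` {m + 1..<N + 1}"
    then obtain i where i: "c = col i" "i \<in> {1..N}" "\<not> i \<le> m"
      by auto
    then show "c \<in> {Suc n..<2 * n}"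
      using int_col[of i] range[of i] pos[of i] by auto
  qed
  show "C \<inter> {Suc n..<2 * n} = col ` {m + 1..<N + 1}"
  proof (intro equalityI subsetI)
    fix c assume c: "c \<in> C \<inter> {Suc n..<2 * n}"
    then have "c \<in> C - {n}"
      by auto
    then obtain i where "c = col i" "i \<in> {1..N}"
      unfolding C col_def by auto
    then show "c \<in> col ` {m + 1..<N + 1}"
      using c col_less_iff[of i] by auto
  next
    fix c assume c: "c \<in> col ` {m + 1..<N + 1}"
    then have "c \<in> C - {n}"
      unfolding C col_def by auto
    then show "c \<in> C \<inter> {Suc n..<2 * n}"
      using c sub by blast
  qed
qed

lemma card_left: "card (C \<inter> {1..<n}) = m"
proof -
  have "C \<inter> {1..<n} = set (filter (\<lambda>c. c \<in> C) [1..<n])"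
    by auto
  moreover have "distinct (filter (\<lambda>c. c \<in> C) [1..<n])"
    by simp
  ultimately show ?thesis
    using distinct_card unfolding filter_left by fastforce
qed

lemma C_subset: "C \<subseteq> {1..<2 * n}"
proof
  fix c assume "c \<in> C"
  show "c \<in> {1..<2 * n}"
  proof (cases "c = n")
    case False
    then have "c \<in> C - {n}"
      using \<open>c \<in> C\<close> by simp
    then obtain i where "c = col i" "i \<in> {1..N}"
      unfolding C col_def by auto
    then show ?thesis
      using int_col[of i] range[of i] by auto
  next
    case True
    then show ?thesis
      using n_pos by simp
  qed
qed

text \<open>A left column with number j ends with the entries (-j, j) and (-j - 1, j + 1). The point
  is minus the order, exactly as powers of negated backward differences produce at 0.\<close>

lemma left_part_eq:
  assumes w: "\<And>i. i \<in> {1..m} \<Longrightarrow> w (2 * i - 1) = (True, nat (- j i)) \<and> w (2 * i) = (True, nat (- j i - 1))"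
  shows "left_part n n C = map (start_point w) [1..<2 * m + 1]"
    and "concat (map (\<lambda>i. [neg_bdiff (2 * i - 1) ^^ nat (- j i), neg_bdiff (2 * i) ^^ nat (- j i - 1)])
      [1..<m + 1]) = map (diff_op w) [1..<2 * m + 1]"
    and "(\<Prod>t\<in>{1..2 * m}. if fst (w t) then (- 1 :: rat) ^ snd (w t) else 1) = (- 1) ^ m"
proof -
  have "left_part n n C = concat (map (\<lambda>i. [(n - col i, column n (col i)),
      (n - Suc (col i), column n (Suc (col i)))]) [1..<m + 1])"
    unfolding left_part_def filter_left by (simp add: comp_def del: upt_Suc)
  also have "\<dots> = concat (map (\<lambda>i. [start_point w (2 * i - 1), start_point w (2 * i)]) [1..<m + 1])"
  proof (intro arg_cong[where f = concat] map_cong refl)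
    fix i assume "i \<in> set [1..<m + 1]"
    then have i: "i \<in> {1..m}" "i \<in> {1..N}"
      using m_le by auto
    have "n - col i = nat (- j i)" "n - Suc (col i) = nat (- j i - 1)"
      using int_col[OF i(2)] neg[OF i(1)] by linarith+
    moreover have "rat_of_nat (col i) = of_nat n + of_int (j i)"
      using arg_cong[OF int_col[OF i(2)], of rat_of_int] by simp
    moreover have "rat_of_nat (nat (- j i)) = - of_int (j i)"
      using neg[OF i(1)] by (simp add: of_nat_nat)
    moreover have "rat_of_nat (nat (- j i - 1)) = - of_int (j i) - 1"
      using neg[OF i(1)] by (simp add: of_nat_nat)
    ultimately show "[(n - col i, column n (col i)), (n - Suc (col i), column n (Suc (col i)))] =
        [start_point w (2 * i - 1), start_point w (2 * i)]"
      using w[OF i(1)] by (simp add: start_point_def column_def)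
  qed
  finally show "left_part n n C = map (start_point w) [1..<2 * m + 1]"
    using concat_map_odd_even[of 0 m "start_point w"] by simp
  have "concat (map (\<lambda>i. [neg_bdiff (2 * i - 1) ^^ nat (- j i), neg_bdiff (2 * i) ^^ nat (- j i - 1)])
      [1..<m + 1]) = concat (map (\<lambda>i. [diff_op w (2 * i - 1), diff_op w (2 * i)]) [1..<m + 1])"
  proof (intro arg_cong[where f = concat] map_cong refl)
    fix i assume "i \<in> set [1..<m + 1]"
    then have "i \<in> {1..m}"
      by auto
    from w[OF this] show "[neg_bdiff (2 * i - 1) ^^ nat (- j i), neg_bdiff (2 * i) ^^ nat (- j i - 1)] =
        [diff_op w (2 * i - 1), diff_op w (2 * i)]"
      by (simp add: diff_op_def)
  qed
  then show "concat (map (\<lambda>i. [neg_bdiff (2 * i - 1) ^^ nat (- j i), neg_bdiff (2 * i) ^^ nat (- j i - 1)])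
      [1..<m + 1]) = map (diff_op w) [1..<2 * m + 1]"
    using concat_map_odd_even[of 0 m "diff_op w"] by simp
  have "(\<Prod>t\<in>{1..2 * k}. if fst (w t) then (- 1 :: rat) ^ snd (w t) else 1) = (- 1) ^ k" if "k \<le> m" for k
    using that
  proof (induction k)
    case (Suc k)
    have eq: "w (2 * k + 1) = (True, nat (- j (Suc k)))" "w (2 * k + 2) = (True, nat (- j (Suc k) - 1))"
      using w[of "Suc k"] Suc.prems by simp_all
    \<comment> \<open>The two exponents are consecutive, so each left column contributes the sign
      -1.\<close>
    have "nat (- j (Suc k)) = Suc (nat (- j (Suc k) - 1))"
      using neg[of "Suc k"] Suc.prems by simp
    then have "(- 1 :: rat) ^ nat (- j (Suc k)) * (- 1) ^ nat (- j (Suc k) - 1) = - 1"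
      by (simp flip: power_mult_distrib)
    then show ?case
      using Suc eq by (simp add: mult.assoc)
  qed simp
  then show "(\<Prod>t\<in>{1..2 * m}. if fst (w t) then (- 1 :: rat) ^ snd (w t) else 1) = (- 1) ^ m"
    by blast
qed

text \<open>After n rows the moving point of the right columns has arrived at the central column,
  that is, at 0.\<close>

lemma right_part_eq:
  "right_part n n C = concat (map (\<lambda>i. [(nat (j i - 1), 0), (nat (j i), 0)]) [m + 1..<N + 1])"
proof -
  have "right_part n n C = concat (map (\<lambda>i. [(col i - Suc n, column n n), (col i - n, column n n)])
      [m + 1..<N + 1])"
    using filter_right by (simp add: right_part_def comp_def mult_2 del: upt_Suc)
  also have "\<dots> = concat (map (\<lambda>i. [(nat (j i - 1), 0), (nat (j i), 0)]) [m + 1..<N + 1])"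
  proof (intro arg_cong[where f = concat] map_cong refl)
    fix i assume "i \<in> set [m + 1..<N + 1]"
    then have i: "i \<in> {m + 1..N}" "i \<in> {1..N}"
      by auto
    have "col i - n = nat (j i)" "col i - Suc n = nat (j i - 1)"
      using int_col[OF i(2)] pos[OF i(1)] by linarith+
    then show "[(col i - Suc n, column n n), (col i - n, column n n)] =
        [(nat (j i - 1), 0), (nat (j i), 0)]"
      by (simp add: column_def)
  qed
  finally show ?thesis .
qed

text \<open>The sign (-1)^m appears twice: from the expansions at the m left 1-columns and from the
  negated backward differences.\<close>

lemma num_states_eq_op_prod:
  assumes "2 * m \<le> n" and points: "state_points n n C = map (start_point w) [1..<n + 1]"
    and w: "\<And>i. i \<in> {1..m} \<Longrightarrow> w (2 * i - 1) = (True, nat (- j i)) \<and> w (2 * i) = (True, nat (- j i - 1))"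
      "\<And>t. 2 * m < t \<Longrightarrow> \<not> fst (w t)"
  shows "of_nat (num_states n n C) = op_prod (map (diff_op w) [1..<n + 1]) (M n) (\<lambda>_. 0)"
proof -
  have "(\<Prod>t\<in>{1..n}. if fst (w t) then (- 1 :: rat) ^ snd (w t) else 1) =
      (\<Prod>t\<in>{1..2 * m}. if fst (w t) then (- 1) ^ snd (w t) else 1)"
    using assms(1) w(2) by (intro prod.mono_neutral_right) auto
  also have "\<dots> = (- 1) ^ m"
    using w(1) by (rule left_part_eq(3))
  finally have prod: "(\<Prod>t\<in>{1..n}. if fst (w t) then (- 1 :: rat) ^ snd (w t) else 1) = (- 1) ^ m" .
  have "length (state_points n n C) = n"
    unfolding points by simp
  from num_states_eq_H[OF order.refl C_subset this] show ?thesis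
    unfolding points card_left op_prod_diff_op_at_0 prod start_point_def .
qed

end

theorem theorem4p2:
  fixes N m :: nat and j :: "nat \<Rightarrow> int"
  assumes "1 \<le> N" and "m \<le> N"
    and "strict_mono_on {1..N} j"
    and "\<And>i. i \<in> {1..m} \<Longrightarrow> j i < 0"
    and "\<And>i. i \<in> {m + 1..N} \<Longrightarrow> 0 < j i"
  shows
    "((\<forall>i\<in>{1..N}. - 2 * int N + 1 \<le> j i \<and> j i \<le> 2 * int N - 1) \<longrightarrow>
       of_nat (num_triangles (2 * N) (j ` {1..N})) =
       op_prod
         (concat (map (\<lambda>i. [neg_bdiff (2 * i - 1) ^^ nat (- j i),
                            neg_bdiff (2 * i) ^^ nat (- j i - 1)]) [1..<m + 1]) @
          concat (map (\<lambda>i. [fdiff (2 * i - 1) ^^ nat (j i - 1),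
                            fdiff (2 * i) ^^ nat (j i)]) [m + 1..<N + 1]))
         (M (2 * N)) (\<lambda>_. 0))
   \<and> ((\<forall>i\<in>{1..N}. - 2 * int N \<le> j i \<and> j i \<le> 2 * int N) \<longrightarrow>
       of_nat (num_triangles (2 * N + 1) (insert 0 (j ` {1..N}))) =
       op_prod
         (concat (map (\<lambda>i. [neg_bdiff (2 * i - 1) ^^ nat (- j i),
                            neg_bdiff (2 * i) ^^ nat (- j i - 1)]) [1..<m + 1]) @
          concat (map (\<lambda>i. [fdiff (2 * i) ^^ nat (j i - 1),
                            fdiff (2 * i + 1) ^^ nat (j i)]) [m + 1..<N + 1]))
         (M (2 * N + 1)) (\<lambda>_. 0))"
proof (intro conjI impI)
  let ?left = "concat (map (\<lambda>i. [neg_bdiff (2 * i - 1) ^^ nat (- j i),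
    neg_bdiff (2 * i) ^^ nat (- j i - 1)]) [1..<m + 1])"
  \<comment> \<open>Variables 2i - 1 and 2i belong to the i-th left column; the divisions by 2
    recover i.\<close>
  let ?wl = "\<lambda>t. (True, if odd t then nat (- j ((t + 1) div 2)) else nat (- j (t div 2) - 1))"
  have wl: "?wl (2 * i - 1) = (True, nat (- j i))" if "1 \<le> i" for i
  proof -
    have "odd (2 * i - 1)" "(2 * i - 1 + 1) div 2 = i"
      using that by simp_all
    then show ?thesis
      by simp
  qed
  have nonzero: "j i \<noteq> 0" if "i \<in> {1..N}" for i
    using assms(4)[of i] assms(5)[of i] that by (cases "i \<le> m") force+
  {
    define n where "n = 2 * N"
    define C where "C = (\<lambda>c. nat (int n + c)) ` (j ` {1..N})"
    assume "\<forall>i\<in>{1..N}. - 2 * int N + 1 \<le> j i \<and> j i \<le> 2 * int N - 1"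
    then have range: "- int n + 1 \<le> j i \<and> j i \<le> int n - 1" if "i \<in> {1..N}" for i
      using that by (simp add: n_def)
    have n: "1 \<le> n"
      using assms(1) by (simp add: n_def)
    have notin: "n \<notin> C"
      using nonzero range by (force simp: C_def)
    interpret one_column_data N m n j C
      by unfold_locales (use assms(2-5) n range notin in \<open>auto simp: C_def image_image\<close>)
    define w where "w t = (if t \<le> 2 * m then ?wl t
      else (False, if odd t then nat (j ((t + 1) div 2) - 1) else nat (j (t div 2))))" for t
    have w: "w (2 * i - 1) = (True, nat (- j i)) \<and> w (2 * i) = (True, nat (- j i - 1))"
      if "i \<in> {1..m}" for i
    proof -
      have "2 * i - 1 \<le> 2 * m" "2 * i \<le> 2 * m" "1 \<le> i"
        using that by auto
      then show ?thesis
        using wl[of i] unfolding w_def by simp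
    qed
    have w': "w (2 * i - 1) = (False, nat (j i - 1)) \<and> w (2 * i) = (False, nat (j i))"
      if "i \<in> {m + 1..N}" for i
    proof -
      have "odd (2 * i - 1)" "(2 * i - 1 + 1) div 2 = i" "\<not> 2 * i - 1 \<le> 2 * m" "\<not> 2 * i \<le> 2 * m"
        using that by auto
      then show ?thesis
        by (simp add: w_def)
    qed
    have left_points: "left_part n n C = map (start_point w) [1..<2 * m + 1]"
      by (rule left_part_eq) (rule w)
    have left_ops: "?left = map (diff_op w) [1..<2 * m + 1]"
      by (rule left_part_eq) (rule w)
    have right_points: "[(nat (j i - 1), 0), (nat (j i), 0)] = [start_point w (2 * i - 1), start_point w (2 * i)]"
      and right_ops: "[fdiff (2 * i - 1) ^^ nat (j i - 1), fdiff (2 * i) ^^ nat (j i)] =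
        [diff_op w (2 * i - 1), diff_op w (2 * i)]" if "i \<in> set [m + 1..<N + 1]" for i
      using w'[of i] that by (auto simp: start_point_def diff_op_def)
    have "right_part n n C = concat (map (\<lambda>i. [start_point w (2 * i - 1), start_point w (2 * i)]) [m + 1..<N + 1])"
      unfolding right_part_eq
      by (intro arg_cong[where f = concat] map_cong refl) (simp only: right_points)
    also have "\<dots> = map (start_point w) [2 * m + 1..<n + 1]"
      unfolding n_def using assms(2) by (rule concat_map_odd_even)
    finally have "state_points n n C = map (start_point w) ([1..<2 * m + 1] @ [2 * m + 1..<n + 1])"
      using notin left_points by (simp add: state_points_def mult_2)
    also have "[1..<2 * m + 1] @ [2 * m + 1..<n + 1] = [1..<n + 1]"
      using upt_add_eq_append[of 1 "2 * m + 1" "n - 2 * m"] assms(2) by (simp add: n_def del: upt_Suc)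
    finally have points: "state_points n n C = map (start_point w) [1..<n + 1]" .
    have "of_nat (num_states n n C) = op_prod (map (diff_op w) [1..<n + 1]) (M n) (\<lambda>_. 0)"
    proof (rule num_states_eq_op_prod[OF _ points])
      show "2 * m \<le> n"
        using assms(2) by (simp add: n_def)
      show "\<not> fst (w t)" if "2 * m < t" for t
        using that by (simp add: w_def)
    qed (rule w)
    moreover have "?left @ concat (map (\<lambda>i. [fdiff (2 * i - 1) ^^ nat (j i - 1),
        fdiff (2 * i) ^^ nat (j i)]) [m + 1..<N + 1]) = map (diff_op w) [1..<n + 1]"
    proof -
      have "concat (map (\<lambda>i. [fdiff (2 * i - 1) ^^ nat (j i - 1), fdiff (2 * i) ^^ nat (j i)]) [m + 1..<N + 1]) =
        concat (map (\<lambda>i. [diff_op w (2 * i - 1), diff_op w (2 * i)]) [m + 1..<N + 1])"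
        by (intro arg_cong[where f = concat] map_cong refl) (simp only: right_ops)
      also have "\<dots> = map (diff_op w) [2 * m + 1..<n + 1]"
        unfolding n_def using assms(2) by (rule concat_map_odd_even)
      finally show ?thesis
        using left_ops \<open>[1..<2 * m + 1] @ [2 * m + 1..<n + 1] = [1..<n + 1]\<close>
        by (metis map_append)
    qed
    moreover have "num_triangles n (j ` {1..N}) = num_states n n C"
      unfolding C_def using n range by (intro num_triangles_eq_num_states) auto
    ultimately show "of_nat (num_triangles (2 * N) (j ` {1..N})) =
       op_prod (?left @ concat (map (\<lambda>i. [fdiff (2 * i - 1) ^^ nat (j i - 1),
                            fdiff (2 * i) ^^ nat (j i)]) [m + 1..<N + 1])) (M (2 * N)) (\<lambda>_. 0)"
      unfolding n_def by simp
  next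
    define n where "n = 2 * N + 1"
    define C where "C = (\<lambda>c. nat (int n + c)) ` insert 0 (j ` {1..N})"
    assume "\<forall>i\<in>{1..N}. - 2 * int N \<le> j i \<and> j i \<le> 2 * int N"
    then have range: "- int n + 1 \<le> j i \<and> j i \<le> int n - 1" if "i \<in> {1..N}" for i
      using that by (simp add: n_def)
    have n: "1 \<le> n"
      by (simp add: n_def)
    have "n \<in> C"
      by (simp add: C_def)
    have notin: "n \<notin> (\<lambda>c. nat (int n + c)) ` (j ` {1..N})"
      using nonzero range by force
    interpret one_column_data N m n j C
      by unfold_locales (use assms(2-5) n range notin in \<open>auto simp: C_def image_image\<close>)
    \<comment> \<open>Variable 2m + 1 belongs to the central column and gets exponent 0. It pushes
      the right columns on by one place, so their pairs start at even indices.\<close>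
    define w where "w t = (if t \<le> 2 * m then ?wl t else if t = 2 * m + 1 then (False, 0)
      else (False, if even t then nat (j (t div 2) - 1) else nat (j (t div 2))))" for t
    have w: "w (2 * i - 1) = (True, nat (- j i)) \<and> w (2 * i) = (True, nat (- j i - 1))"
      if "i \<in> {1..m}" for i
    proof -
      have "2 * i - 1 \<le> 2 * m" "2 * i \<le> 2 * m" "1 \<le> i"
        using that by auto
      then show ?thesis
        using wl[of i] unfolding w_def by simp
    qed
    have w': "w (2 * i) = (False, nat (j i - 1)) \<and> w (2 * i + 1) = (False, nat (j i))"
      if "i \<in> {m + 1..N}" for i
      using that by (simp add: w_def)
    have left_points: "left_part n n C = map (start_point w) [1..<2 * m + 1]"
      by (rule left_part_eq) (rule w)
    have left_ops: "?left = map (diff_op w) [1..<2 * m + 1]"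
      by (rule left_part_eq) (rule w)
    have right_points: "[(nat (j i - 1), 0), (nat (j i), 0)] = [start_point w (2 * i), start_point w (2 * i + 1)]"
      and right_ops: "[fdiff (2 * i) ^^ nat (j i - 1), fdiff (2 * i + 1) ^^ nat (j i)] =
        [diff_op w (2 * i), diff_op w (2 * i + 1)]" if "i \<in> set [m + 1..<N + 1]" for i
      using w'[of i] that by (auto simp: start_point_def diff_op_def)
    have split: "[1..<n + 1] = [1..<2 * m + 1] @ (2 * m + 1) # [2 * m + 2..<n + 1]"
      using upt_add_eq_append[of 1 "2 * m + 1" "n - 2 * m"] upt_conv_Cons[of "2 * m + 1" "n + 1"] assms(2)
      by (simp add: n_def del: upt_Suc)
    have n1: "n + 1 = 2 * N + 2"
      by (simp add: n_def)
    have "right_part n n C = concat (map (\<lambda>i. [start_point w (2 * i), start_point w (2 * i + 1)]) [m + 1..<N + 1])"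
      unfolding right_part_eq
      by (intro arg_cong[where f = concat] map_cong refl) (simp only: right_points)
    also have "\<dots> = map (start_point w) [2 * m + 2..<n + 1]"
      unfolding n1 using assms(2) by (rule concat_map_even_odd)
    finally have points: "state_points n n C = map (start_point w) [1..<n + 1]"
      using \<open>n \<in> C\<close> left_points unfolding split
      by (simp add: state_points_def mult_2 start_point_def w_def column_def)
    have "of_nat (num_states n n C) = op_prod (map (diff_op w) [1..<n + 1]) (M n) (\<lambda>_. 0)"
    proof (rule num_states_eq_op_prod[OF _ points])
      show "2 * m \<le> n"
        using assms(2) by (simp add: n_def)
      show "\<not> fst (w t)" if "2 * m < t" for t
        using that by (simp add: w_def)
    qed (rule w)
    moreover have "op_prod (?left @ concat (map (\<lambda>i. [fdiff (2 * i) ^^ nat (j i - 1),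
        fdiff (2 * i + 1) ^^ nat (j i)]) [m + 1..<N + 1])) = op_prod (map (diff_op w) [1..<n + 1])"
    proof -
      have "concat (map (\<lambda>i. [fdiff (2 * i) ^^ nat (j i - 1), fdiff (2 * i + 1) ^^ nat (j i)]) [m + 1..<N + 1]) =
        concat (map (\<lambda>i. [diff_op w (2 * i), diff_op w (2 * i + 1)]) [m + 1..<N + 1])"
        by (intro arg_cong[where f = concat] map_cong refl) (simp only: right_ops)
      also have "\<dots> = map (diff_op w) [2 * m + 2..<n + 1]"
        unfolding n1 using assms(2) by (rule concat_map_even_odd)
      finally have right: "concat (map (\<lambda>i. [fdiff (2 * i) ^^ nat (j i - 1),
        fdiff (2 * i + 1) ^^ nat (j i)]) [m + 1..<N + 1]) = map (diff_op w) [2 * m + 2..<n + 1]" .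
      \<comment> \<open>The formula lists no operator for the central variable; its zeroth power is
        the identity.\<close>
      have "diff_op w (2 * m + 1) f = f" for f
        by (simp add: diff_op_def w_def)
      then show ?thesis
        unfolding right left_ops split map_append list.map
        by (intro ext) (simp only: op_prod_append op_prod_Cons)
    qed
    moreover have "num_triangles n (insert 0 (j ` {1..N})) = num_states n n C"
      unfolding C_def using n range by (intro num_triangles_eq_num_states) auto
    ultimately show "of_nat (num_triangles (2 * N + 1) (insert 0 (j ` {1..N}))) =
       op_prod (?left @ concat (map (\<lambda>i. [fdiff (2 * i) ^^ nat (j i - 1),
                            fdiff (2 * i + 1) ^^ nat (j i)]) [m + 1..<N + 1])) (M (2 * N + 1)) (\<lambda>_. 0)"
      unfolding n_def by simp
  }
qed

end
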